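(* Let $l:[0,1]\to[0,1]$ be a monotone increasing function that is slowly varying at $0$ and satisfies $\lim_{u\to0}l(u)=0$, and consider the SAMBA process with learning-rate function $$\alpha(p)=\frac{1}{p^2}\int_0^p\int_0^v l(u)\,du\,dv.$$ Then $(\mathbf p(t))_{t\in\mathbb Z_+}$ is a Markov chain, with probability $1$ we have $p_{a^\star}(t)\to1$ as $t\to\infty$, and there exists a constant $C>0$ such that for every $T\in\mathbb N$ with $C/(\Delta T)\le1$, $$\mathrm{Rg}(T)\le \frac{CN}{\Delta\, l\big(\frac{C}{\Delta T}\big)}\log T+Q+1,$$ where $Q:=\sum_{t=0}^\infty\mathbb P\big(p_{a^\star}(t)\le\frac12\big)$.
   Context: A function $l$ is slowly varying at $0$ if it is positive (on $(0,1]$ here) and $\lim_{x\to0}l(\lambda x)/l(x)=1$ for every $\lambda>0$. Bandit model: $\mathcal A$ is a finite set of arms, $N=|\mathcal A|$. For each arm $a$ and time $t\in\mathbb Z_+=\{0,1,2,\dots\}$, $R_a(t)\in\{0,1\}$ is a Bernoulli random variable with mean $r_a\in[0,1]$; all $R_a(t)$ are independent. There is a unique optimal arm $a^\star$ with $r^\star:=r_{a^\star}>r_a$ for all $a\ne a^\star$, and $\Delta:=r^\star-\max_{a\neq a^\star}r_a>0$. SAMBA process with learning-rate function $\alpha$: $\mathbf p(0)$ is a probability vector on $\mathcal A$ with all entries positive. At each time $t$, let $a_\star(t)$ be an arm maximizing $p_a(t)$ (ties broken uniformly at random) and $p_\star(t)=p_{a_\star(t)}(t)$. Exactly one arm is played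 at time $t$, arm $a$ with conditional probability $p_a(t)$ given the past (using independent randomization); $I_a(t)$ is the indicator that $a$ is played, $I_\star(t)=I_{a_\star(t)}(t)$, $R_\star(t)=R_{a_\star(t)}(t)$. For each $a\ne a_\star(t)$, $$p_a(t+1)=p_a(t)+\alpha(p_a(t))\,p_a(t)^2\Big[\frac{I_a(t)R_a(t)}{p_a(t)}-\frac{I_\star(t)R_\star(t)}{p_\star(t)}\Big],$$ and $p_{a_\star(t)}(t+1)=1-\sum_{a\ne a_\star(t)}p_a(t+1)$. Regret: $\mathrm{Rg}(T)=r^\star T-\mathbb E\big[\sum_{t=0}^{T-1}\sum_{a\in\mathcal A}I_a(t)R_a(t)\big]$. *)

theory Defs
  imports "HOL-Probability.Probability"
begin

text \<open>Arms are the natural numbers 0,...,N-1. A state is a function nat => real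
  (probability vector, components at index >= N are irrelevant / zero).\<close>

definition slowly_varying_at_0 :: "(real \<Rightarrow> real) \<Rightarrow> bool" where
  "slowly_varying_at_0 l \<longleftrightarrow>
     (\<forall>x\<in>{0<..1}. l x > 0) \<and>
     (\<forall>c>0. ((\<lambda>x. l (c * x) / l x) \<longlongrightarrow> 1) (at_right 0))"

definition samba_alpha :: "(real \<Rightarrow> real) \<Rightarrow> real \<Rightarrow> real" where
  "samba_alpha l p = (1 / p\<^sup>2) * integral {0..p} (\<lambda>v. integral {0..v} l)"

text \<open>Leader a_star(t): uniform tie-breaking among the maximisers of p,
  driven by a uniform random number v in [0,1].\<close>
definition samba_leader :: "nat \<Rightarrow> (nat \<Rightarrow> real) \<Rightarrow> real \<Rightarrow> nat" where
  "samba_leader N p v =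
     (let A = {a. a < N \<and> (\<forall>c<N. p c \<le> p a)}; k = card A
      in sorted_list_of_set A ! min (nat \<lfloor>v * real k\<rfloor>) (k - 1))"

text \<open>Played arm: arm b is played iff u lies in [p_0+...+p_(b-1), p_0+...+p_b),
  driven by a uniform random number u in [0,1]; so arm b is played with probability p b.\<close>
definition samba_play :: "nat \<Rightarrow> (nat \<Rightarrow> real) \<Rightarrow> real \<Rightarrow> nat" where
  "samba_play N p u =
     (if \<exists>b<N. u < (\<Sum>c\<le>b. p c) then (LEAST b. b < N \<and> u < (\<Sum>c\<le>b. p c)) else N - 1)"

definition samba_step :: "(real \<Rightarrow> real) \<Rightarrow> nat \<Rightarrow> (nat \<Rightarrow> real)
    \<Rightarrow> (nat \<Rightarrow> bool) \<times> real \<times> real \<Rightarrow> (nat \<Rightarrow> real)" where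
  "samba_step \<alpha> N p w =
     (case w of (R, u, v) \<Rightarrow>
       (let s = samba_leader N p v; b = samba_play N p u;
            q = (\<lambda>a. if a < N \<and> a \<noteq> s then
                   p a + \<alpha> (p a) * (p a)\<^sup>2 *
                     ((if a = b \<and> R a then 1 else 0) / p a - (if s = b \<and> R s then 1 else 0) / p s)
                 else 0)
        in q(s := 1 - (\<Sum>a\<in>{..<N} - {s}. q a))))"

primrec samba_p :: "(real \<Rightarrow> real) \<Rightarrow> nat \<Rightarrow> (nat \<Rightarrow> real)
    \<Rightarrow> (nat \<Rightarrow> (nat \<Rightarrow> bool) \<times> real \<times> real) \<Rightarrow> nat \<Rightarrow> (nat \<Rightarrow> real)" where
  "samba_p \<alpha> N p0 \<omega> 0 = p0"
| "samba_p \<alpha> N p0 \<omega> (Suc t) = samba_step \<alpha> N (samba_p \<alpha> N p0 \<omega> t) (\<omega> t)"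

definition samba_reward :: "(real \<Rightarrow> real) \<Rightarrow> nat \<Rightarrow> (nat \<Rightarrow> real)
    \<Rightarrow> (nat \<Rightarrow> (nat \<Rightarrow> bool) \<times> real \<times> real) \<Rightarrow> nat \<Rightarrow> real" where
  "samba_reward \<alpha> N p0 \<omega> t =
     (\<Sum>a<N. (if samba_play N (samba_p \<alpha> N p0 \<omega> t) (fst (snd (\<omega> t))) = a then 1 else 0)
             * (if fst (\<omega> t) a then 1 else 0))"

definition samba_noise :: "nat \<Rightarrow> (nat \<Rightarrow> real) \<Rightarrow> ((nat \<Rightarrow> bool) \<times> real \<times> real) measure" where
  "samba_noise N r =
     measure_pmf (Pi_pmf {..<N} False (\<lambda>a. bernoulli_pmf (r a)))
       \<Otimes>\<^sub>M (uniform_measure lborel {0..1::real} \<Otimes>\<^sub>M uniform_measure lborel {0..1::real})"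

definition samba_space :: "nat \<Rightarrow> (nat \<Rightarrow> real)
    \<Rightarrow> (nat \<Rightarrow> (nat \<Rightarrow> bool) \<times> real \<times> real) measure" where
  "samba_space N r = (\<Pi>\<^sub>M t\<in>UNIV. samba_noise N r)"

definition samba_regret :: "(real \<Rightarrow> real) \<Rightarrow> nat \<Rightarrow> (nat \<Rightarrow> real) \<Rightarrow> nat
    \<Rightarrow> (nat \<Rightarrow> real) \<Rightarrow> nat \<Rightarrow> real" where
  "samba_regret \<alpha> N r astar p0 T =
     r astar * real T
     - (\<integral>\<omega>. (\<Sum>t<T. samba_reward \<alpha> N p0 \<omega> t) \<partial>samba_space N r)"

definition markov_chain :: "'w measure \<Rightarrow> 's measure \<Rightarrow> (nat \<Rightarrow> 'w \<Rightarrow> 's) \<Rightarrow> bool" where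
  "markov_chain M S X \<longleftrightarrow>
     (\<forall>t. X t \<in> M \<rightarrow>\<^sub>M S) \<and>
     (\<exists>K \<in> S \<rightarrow>\<^sub>M prob_algebra S.
        \<forall>t (B :: nat \<Rightarrow> 's set) B'. (\<forall>i\<le>t. B i \<in> sets S) \<longrightarrow> B' \<in> sets S \<longrightarrow>
          measure M {\<omega> \<in> space M. (\<forall>i\<le>t. X i \<omega> \<in> B i) \<and> X (Suc t) \<omega> \<in> B'}
          = (\<integral>\<omega>. indicator {\<omega> \<in> space M. \<forall>i\<le>t. X i \<omega> \<in> B i} \<omega> * measure (K (X t \<omega>)) B' \<partial>M))"

end

theory Submission
  imports Defs
begin

text \<open>
  Let \<open>Q t\<close> be the probability of the optimal arm at time \<open>t\<close> and \<open>G x = \<alpha> x * x\<^sup>2\<close>. A non-leading arm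
  \<open>a\<close> has drift \<open>G (p a) * (r a - r s)\<close>, where \<open>s\<close> is the leader. Hence \<open>Q\<close> is a bounded
  submartingale with drift at least \<open>\<Delta> * G (min (Q t) (1 - Q t) / N)\<close>; summability of the drift forces
  \<open>min (Q t) (1 - Q t)\<close> to 0, and bounded step ratios then give \<open>Q t\<close> converging to 0 or to 1. As \<open>\<alpha>\<close> vanishes
  at 0, \<open>1 / Q\<close> is a supermartingale while \<open>Q\<close> is small, which excludes the limit 0.

  For the regret, consider the concave potential \<open>\<Phi> = (\<Sum>a\<noteq>astar. ln (p a + \<epsilon>))\<close> with \<open>\<epsilon> = C / (\<Delta> * T)\<close>.
  While \<open>Q t > 1/2\<close> its drift is at most \<open>- \<Delta> * (\<Sum>a\<noteq>astar. G (p a) / (p a + \<epsilon>))\<close>, and since \<open>\<alpha>\<close> is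
  increasing each \<open>p a\<close> is at most \<open>\<epsilon> + 2 / \<alpha> \<epsilon> * (G (p a) / (p a + \<epsilon>))\<close>; otherwise the drift is at most
  \<open>N\<^sup>2\<close>. As \<open>\<Phi>\<close> varies by at most \<open>N * ln (2 / \<epsilon>)\<close> and \<open>\<alpha> \<epsilon>\<close> is comparable to \<open>l \<epsilon>\<close>, summing over
  \<open>t < T\<close> gives the bound, with a constant \<open>C\<close> that also absorbs the expected number of times
  with \<open>Q t \<le> 1/2\<close>.
\<close>

section \<open>The learning rate\<close>

text \<open>Slow variation with factor 1/4 keeps the ratio above 1/2 near 0; away from 0
  monotonicity keeps \<open>l (x / 4)\<close> above one fixed positive value, while
  \<open>l x \<le> 1\<close>. The constant is uniform on (0,1] because it later compares the
  learning rate with \<open>l\<close> at the same point.\<close>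

lemma slowly_varying_quarter_ratio:
  fixes l :: "real \<Rightarrow> real"
  assumes range: "\<forall>x\<in>{0..1}. l x \<in> {0..1}" and mono: "mono_on {0..1} l"
    and sv: "slowly_varying_at_0 l"
  obtains c where "c > 0" "\<And>x. 0 < x \<Longrightarrow> x \<le> 1 \<Longrightarrow> c * l x \<le> l (x / 4)"
proof -
  have pos: "l x > 0" if "0 < x" "x \<le> 1" for x
    using sv that unfolding slowly_varying_at_0_def by auto
  have "((\<lambda>x. l (1/4 * x) / l x) \<longlongrightarrow> 1) (at_right 0)"
    using sv unfolding slowly_varying_at_0_def by (auto dest: spec[of _ "1/4"])
  from order_tendstoD(1)[OF this, of "1/2"]
  have "eventually (\<lambda>x. 1/2 < l (1/4 * x) / l x) (at_right 0)" by simp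
  then obtain d where d: "d > 0" "\<And>x. 0 < x \<Longrightarrow> x < d \<Longrightarrow> 1/2 < l (1/4 * x) / l x"
    unfolding eventually_at_right_field by auto
  define e where "e = min d 1"
  have e: "0 < e" "e \<le> 1" "e \<le> d" using d by (auto simp: e_def)
  have le: "l (e/4) > 0" using pos[of "e/4"] e by simp
  show thesis
  proof
    show "min (1/2) (l (e/4)) > 0" using le by simp
    fix x :: real assume x: "0 < x" "x \<le> 1"
    show "min (1/2) (l (e/4)) * l x \<le> l (x / 4)"
    proof (cases "x < e")
      case True
      then have "1/2 < l (1/4 * x) / l x" using d(2) x e by auto
      then have "1/2 * l x \<le> l (x/4)" using pos[OF x] by (simp add: field_simps)
      then show ?thesis using pos[OF x] mult_right_mono[of "min (1/2) (l (e/4))" "1/2" "l x"] by linarith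
    next
      case False
      have "min (1/2) (l (e/4)) * l x \<le> l (e/4) * 1"
        using range x le by (intro mult_mono) auto
      also have "\<dots> \<le> l (x/4)"
        using False x e by (auto intro!: mono_onD[OF mono])
      finally show ?thesis .
    qed
  qed
qed

text \<open>If \<open>f\<close> is not integrable, neither is its stretched version, and both sides
  take the default value 0.\<close>

lemma integral_rescale_unit:
  fixes f :: "real \<Rightarrow> real"
  assumes "p > 0"
  shows "integral {0..p} f = p * integral {0..1} (\<lambda>x. f (p * x))"
proof -
  have "(\<lambda>x. x / p) ` {0..p} = {0..1}"
    using assms by (simp add: image_divide_atLeastAtMost)
  then show ?thesis
    using integral_stretch_real[of p 0 p f] assms by (simp add: field_simps)
qed

text \<open>Stretching both variables to the unit interval cancels \<open>1 / p\<^sup>2\<close>.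
  With the domain of integration fixed, monotonicity and bounds of \<open>l\<close> can be used
  under the integral sign.\<close>

lemma samba_alpha_rescaled:
  fixes l :: "real \<Rightarrow> real"
  assumes "p > 0"
  shows "samba_alpha l p = integral {0..1} (\<lambda>v. v * integral {0..1} (\<lambda>u. l (p * v * u)))"
proof -
  have "integral {0..p * v} l = p * (v * integral {0..1} (\<lambda>u. l (p * v * u)))" if "v \<in> {0..1}" for v
    using that assms integral_rescale_unit[of "p * v" l] by (cases "v = 0") auto
  then have "integral {0..1} (\<lambda>v. integral {0..p * v} l)
      = integral {0..1} (\<lambda>v. p * (v * integral {0..1} (\<lambda>u. l (p * v * u))))"
    by (intro integral_cong) auto
  then show ?thesis
    unfolding samba_alpha_def using assms
    by (simp add: integral_rescale_unit[of p "\<lambda>v. integral {0..v} l"] power2_eq_square)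
qed

context
  fixes l :: "real \<Rightarrow> real"
  assumes range: "\<forall>x\<in>{0..1}. l x \<in> {0..1}" and mono: "mono_on {0..1} l"
begin

private lemma inner_integrable:
  assumes "0 \<le> c" "c \<le> 1"
  shows "(\<lambda>u. l (c * u)) integrable_on {0..1}"
  using assms by (intro integrable_on_mono_on mono_onI mono_onD[OF mono])
    (auto simp: mult_le_one intro: mult_left_mono)

private lemma inner_bounds:
  assumes "0 \<le> c" "c \<le> d" "d \<le> 1"
  shows "integral {0..1} (\<lambda>u. l (c * u)) \<le> integral {0..1} (\<lambda>u. l (d * u))"
    "0 \<le> integral {0..1} (\<lambda>u. l (c * u))" "integral {0..1} (\<lambda>u. l (c * u)) \<le> l d"
proof -
  show "integral {0..1} (\<lambda>u. l (c * u)) \<le> integral {0..1} (\<lambda>u. l (d * u))"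
    using assms by (intro integral_le inner_integrable mono_onD[OF mono])
      (auto simp: mult_le_one intro: mult_right_mono)
  show "0 \<le> integral {0..1} (\<lambda>u. l (c * u))"
    using assms range by (intro integral_nonneg inner_integrable) (auto simp: mult_le_one)
  have "integral {0..1} (\<lambda>u. l (c * u)) \<le> integral {0..1} (\<lambda>u::real. l d)"
    using assms
  proof (intro integral_le inner_integrable mono_onD[OF mono])
    fix u :: real assume u: "u \<in> {0..1}"
    have "c * u \<le> d * 1" using assms u by (intro mult_mono) auto
    then show "c * u \<le> d" by simp
  qed (auto simp: mult_le_one)
  then show "integral {0..1} (\<lambda>u. l (c * u)) \<le> l d" by simp
qed

private lemma outer_integrable:
  assumes "0 \<le> p" "p \<le> 1"
  shows "(\<lambda>v. v * integral {0..1} (\<lambda>u. l (p * v * u))) integrable_on {0..1}"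
  using assms
  by (intro integrable_on_mono_on mono_onI mult_mono inner_bounds)
    (auto simp: mult_le_one mult_left_le intro: mult_left_mono order.trans)

lemma samba_alpha_mono:
  assumes "0 < x" "x \<le> y" "y \<le> 1"
  shows "samba_alpha l x \<le> samba_alpha l y"
proof -
  have "0 < y" using assms by simp
  then show ?thesis using assms
    by (simp only: samba_alpha_rescaled)
      (intro integral_le outer_integrable mult_left_mono inner_bounds;
       auto simp: mult_le_one mult_right_mono)
qed

text \<open>The inner average is at most \<open>l x\<close> and the weight \<open>v\<close> has
  integral 1/2. The bound makes the rate at most 1/2 and lets it vanish at 0 together with
  \<open>l\<close>.\<close>

lemma samba_alpha_le:
  assumes "0 < x" "x \<le> 1"
  shows "samba_alpha l x \<le> l x / 2"
proof -
  have "samba_alpha l x = integral {0..1} (\<lambda>v. v * integral {0..1} (\<lambda>u. l (x * v * u)))"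
    using assms by (simp add: samba_alpha_rescaled)
  also have "\<dots> \<le> integral {0..1} (\<lambda>v. v * l x)"
    using assms
    by (intro integral_le outer_integrable mult_left_mono inner_bounds)
      (auto simp: mult_le_one mult_left_le integrable_on_mult_left ident_integrable_on)
  also have "\<dots> = l x / 2"
    using ident_has_integral[of 0 "1::real"] by (simp add: integral_unique)
  finally show ?thesis .
qed

text \<open>On the square where \<open>u\<close> and \<open>v\<close> are at least 1/2 the argument
  of \<open>l\<close> is at least \<open>x / 4\<close>. The inner integral gives a factor 1/2, the
  outer one 1/2 for the weight and 1/2 for the length.\<close>

lemma samba_alpha_ge:
  assumes "0 < x" "x \<le> 1"
  shows "l (x / 4) / 8 \<le> samba_alpha l x"
proof -
  have inner: "l (x / 4) / 2 \<le> integral {0..1} (\<lambda>u. l (x * v * u))" if v: "v \<in> {1/2..1}" for v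
  proof -
    have xv: "0 \<le> x * v" "x * v \<le> 1" using assms v by (auto simp: mult_le_one)
    have int: "(\<lambda>u. l (x * v * u)) integrable_on {0..1}" by (rule inner_integrable[OF xv])
    then have int': "(\<lambda>u. l (x * v * u)) integrable_on {1/2..1}"
      by (rule integrable_subinterval_real) auto
    have "l (x / 4) / 2 = integral {1/2..1::real} (\<lambda>u. l (x / 4))" by simp
    also have "\<dots> \<le> integral {1/2..1} (\<lambda>u. l (x * v * u))"
    proof (intro integral_le int' mono_onD[OF mono])
      fix u :: real assume u: "u \<in> {1/2..1}"
      have "1/2 * (1/2) \<le> v * u" using u v by (intro mult_mono) auto
      then show "x / 4 \<le> x * v * u" using assms by (simp add: mult.assoc)
      show "x * v * u \<in> {0..1}" using xv u by (auto simp: mult_le_one)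
    qed (use assms in auto)
    also have "\<dots> \<le> integral {0..1} (\<lambda>u. l (x * v * u))"
      using xv range by (intro integral_subset_le int int') (auto simp: mult_le_one)
    finally show ?thesis .
  qed
  have int: "(\<lambda>v. v * integral {0..1} (\<lambda>u. l (x * v * u))) integrable_on {0..1}"
    using assms by (intro outer_integrable) auto
  then have int': "(\<lambda>v. v * integral {0..1} (\<lambda>u. l (x * v * u))) integrable_on {1/2..1}"
    by (rule integrable_subinterval_real) auto
  have lx: "0 \<le> l (x/4)" using range assms by auto
  have "l (x / 4) / 8 = integral {1/2..1::real} (\<lambda>v. 1/2 * (l (x / 4) / 2))" by simp
  also have "\<dots> \<le> integral {1/2..1} (\<lambda>v. v * integral {0..1} (\<lambda>u. l (x * v * u)))"
    using inner lx by (intro integral_le int' mult_mono) auto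
  also have "\<dots> \<le> integral {0..1} (\<lambda>v. v * integral {0..1} (\<lambda>u. l (x * v * u)))"
  proof (intro integral_subset_le int int' ballI)
    fix v :: real assume "v \<in> {0..1}"
    then show "0 \<le> v * integral {0..1} (\<lambda>u. l (x * v * u))"
      using assms by (intro mult_nonneg_nonneg inner_bounds(2)[of "x * v" "x * v"]) (auto simp: mult_le_one)
  qed auto
  also have "\<dots> = samba_alpha l x"
    using assms by (simp add: samba_alpha_rescaled)
  finally show ?thesis .
qed

end

section \<open>Measurability and the Markov property\<close>

text \<open>Overwriting one coordinate by an independent copy preserves the product measure, and
  Fubini integrates the copy first. This identity takes over the role of conditioning on the past at
  time \<open>t\<close>.\<close>

lemma (in prob_space) PiM_resample:
  fixes h :: "(nat \<Rightarrow> 'a) \<Rightarrow> real"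
  assumes h: "integrable (PiM UNIV (\<lambda>_. M)) h"
  shows "(\<integral>\<omega>. h \<omega> \<partial>PiM UNIV (\<lambda>_. M)) = (\<integral>\<omega>. (\<integral>w. h (fun_upd \<omega> t w) \<partial>M) \<partial>PiM UNIV (\<lambda>_. M))"
    and "integrable (PiM UNIV (\<lambda>_. M)) (\<lambda>\<omega>. \<integral>w. h (fun_upd \<omega> t w) \<partial>M)"
proof -
  let ?P = "PiM UNIV (\<lambda>_::nat. M)" and ?f = "\<lambda>(x, X :: nat \<Rightarrow> 'a). fun_upd X t x"
  interpret P: prob_space ?P by (intro prob_space_PiM) unfold_locales
  interpret pair_sigma_finite M ?P by unfold_locales
  have f[measurable]: "?f \<in> M \<Otimes>\<^sub>M ?P \<rightarrow>\<^sub>M ?P"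
    unfolding split_beta' by (rule measurable_fun_upd[where J=UNIV]) auto
  have D: "distr (M \<Otimes>\<^sub>M ?P) ?P ?f = ?P"
    using distr_pair_PiM_eq_PiM[of UNIV "\<lambda>_. M" t] prob_space_axioms by simp
  have meas: "h \<in> borel_measurable ?P" using h by simp
  have "integrable (distr (M \<Otimes>\<^sub>M ?P) ?P ?f) h" using h by (simp add: D)
  then have int: "integrable (M \<Otimes>\<^sub>M ?P) (\<lambda>(w, \<omega>). h (fun_upd \<omega> t w))"
    using integrable_distr[OF f] by (simp add: split_beta')
  have "(\<integral>\<omega>. h \<omega> \<partial>?P) = (\<integral>x. h (?f x) \<partial>(M \<Otimes>\<^sub>M ?P))"
    using integral_distr[OF f meas] by (simp add: D)
  also have "\<dots> = (\<integral>\<omega>. (\<integral>w. h (fun_upd \<omega> t w) \<partial>M) \<partial>?P)"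
    using integral_snd[OF int] by (simp add: split_beta')
  finally show "(\<integral>\<omega>. h \<omega> \<partial>?P) = (\<integral>\<omega>. (\<integral>w. h (fun_upd \<omega> t w) \<partial>M) \<partial>?P)" .
  show "integrable ?P (\<lambda>\<omega>. \<integral>w. h (fun_upd \<omega> t w) \<partial>M)"
    using integrable_snd[OF int] .
qed

section \<open>State space, noise and measurable dynamics\<close>

abbreviation state_space :: "(nat \<Rightarrow> real) measure" where
  "state_space \<equiv> \<Pi>\<^sub>M a\<in>(UNIV::nat set). (borel :: real measure)"

lemma prob_space_samba_noise: "prob_space (samba_noise N r)"
proof -
  interpret U: prob_space "uniform_measure lborel {0..1::real}"
    by (intro prob_space_uniform_measure) auto
  interpret UU: pair_prob_space "uniform_measure lborel {0..1::real}" "uniform_measure lborel {0..1::real}" ..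
  interpret W: pair_prob_space "measure_pmf (Pi_pmf {..<N} False (\<lambda>a. bernoulli_pmf (r a)))"
    "uniform_measure lborel {0..1::real} \<Otimes>\<^sub>M uniform_measure lborel {0..1::real}" ..
  show ?thesis unfolding samba_noise_def by (rule W.prob_space_axioms)
qed

lemma prob_space_samba_space: "prob_space (samba_space N r)"
  unfolding samba_space_def by (intro prob_space_PiM prob_space_samba_noise)

lemma space_samba_noise [simp]: "space (samba_noise N r) = UNIV"
  unfolding samba_noise_def by (simp add: space_pair_measure)

lemma space_samba_space [simp]: "space (samba_space N r) = UNIV"
  unfolding samba_space_def by (simp add: space_PiM)

lemma sets_samba_noise [measurable_cong]:
  "sets (samba_noise N r) = sets (count_space UNIV \<Otimes>\<^sub>M (borel \<Otimes>\<^sub>M borel))"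
  unfolding samba_noise_def by (intro sets_pair_measure_cong) auto

lemma measurable_state_component:
  "(\<lambda>x. fst x a) \<in> borel_measurable (state_space \<Otimes>\<^sub>M M)"
  by (rule measurable_compose[OF measurable_fst measurable_component_singleton]) simp

text \<open>The set of maximisers has only finitely many possible values, each attained on a set cut
  out by finitely many comparisons of coordinates. For each fixed value the leader is a measurable
  function of \<open>v\<close>.\<close>

lemma measurable_samba_leader:
  "(\<lambda>(p, v). samba_leader N p v) \<in> state_space \<Otimes>\<^sub>M borel \<rightarrow>\<^sub>M count_space UNIV"
proof -
  let ?A = "\<lambda>p :: nat \<Rightarrow> real. {a. a < N \<and> (\<forall>c<N. p c \<le> p a)}"
  have A: "(\<lambda>x :: (nat \<Rightarrow> real) \<times> real. ?A (fst x)) \<in> state_space \<Otimes>\<^sub>M borel \<rightarrow>\<^sub>M count_space (Pow {..<N})"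
  proof (subst measurable_count_space_eq2, simp, intro conjI ballI)
    fix A assume "A \<in> Pow {..<N}"
    then have "?A p = A \<longleftrightarrow> (\<forall>a\<in>{..<N}. (\<forall>c\<in>{..<N}. p c \<le> p a) = (a \<in> A))" for p
      by (simp add: set_eq_iff Ball_def) (metis lessThan_iff subsetD)
    then have "(\<lambda>x :: (nat \<Rightarrow> real) \<times> real. ?A (fst x)) -` {A} \<inter> space (state_space \<Otimes>\<^sub>M borel)
        = {x \<in> space (state_space \<Otimes>\<^sub>M borel). \<forall>a\<in>{..<N}. (\<forall>c\<in>{..<N}. fst x c \<le> fst x a) = (a \<in> A)}"
      by (simp add: vimage_def Int_def conj_commute)
    also have "\<dots> \<in> sets (state_space \<Otimes>\<^sub>M borel)"
    proof -
      note measurable_state_component[measurable]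
      have "Measurable.pred (state_space \<Otimes>\<^sub>M borel) (\<lambda>x. (\<forall>c\<in>{..<N}. fst x c \<le> fst x a) = (a \<in> A))" for a
        by (cases "a \<in> A") (simp_all, measurable)
      then show ?thesis
        unfolding pred_def by (intro sets.sets_Collect_finite_All) auto
    qed
    finally show "(\<lambda>x :: (nat \<Rightarrow> real) \<times> real. ?A (fst x)) -` {A} \<inter> space (state_space \<Otimes>\<^sub>M borel)
      \<in> sets (state_space \<Otimes>\<^sub>M borel)" .
  qed auto
  show ?thesis
    unfolding samba_leader_def Let_def split_beta'
    by (rule measurable_compose_countable'[OF _ A]) (auto intro!: countable_finite)
qed

lemma measurable_samba_play:
  "(\<lambda>(p, u). samba_play N p u) \<in> state_space \<Otimes>\<^sub>M borel \<rightarrow>\<^sub>M count_space UNIV"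
proof -
  note measurable_state_component[measurable]
  have [measurable]: "Measurable.pred (state_space \<Otimes>\<^sub>M borel) (\<lambda>x. b < N \<and> snd x < (\<Sum>c\<le>b. fst x c))" for b
    by measurable
  show ?thesis unfolding samba_play_def split_beta' by measurable
qed

lemma measurable_samba_step:
  assumes [measurable]: "\<alpha> \<in> borel_measurable borel"
  shows "(\<lambda>(p, w). samba_step \<alpha> N p w) \<in> state_space \<Otimes>\<^sub>M samba_noise N' r \<rightarrow>\<^sub>M state_space"
proof -
  let ?S = "state_space \<Otimes>\<^sub>M (count_space UNIV \<Otimes>\<^sub>M (borel \<Otimes>\<^sub>M borel)) :: ((nat \<Rightarrow> real) \<times> (nat \<Rightarrow> bool) \<times> real \<times> real) measure"
  define q :: "nat \<Rightarrow> nat \<Rightarrow> nat \<Rightarrow> (nat \<Rightarrow> real) \<times> (nat \<Rightarrow> bool) \<times> real \<times> real \<Rightarrow> real" where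
    "q = (\<lambda>s b a x. if a < N \<and> a \<noteq> s then fst x a + \<alpha> (fst x a) * (fst x a)\<^sup>2 *
        ((if a = b \<and> fst (snd x) a then 1 else 0) / fst x a - (if s = b \<and> fst (snd x) s then 1 else 0) / fst x s)
        else 0)"
  note measurable_state_component[measurable]
  \<comment> \<open>With leader \<open>s\<close> and played arm \<open>b\<close> frozen, every
    coordinate of the new state is measurable; the true step is glued from countably many such
    pieces.\<close>
  define step where "step = (\<lambda>s b a x. if a = s then 1 - (\<Sum>c\<in>{..<N} - {s}. q s b c x) else q s b a x)"
  have [measurable]: "(\<lambda>x. fst (snd x) a) \<in> ?S \<rightarrow>\<^sub>M count_space UNIV" for a
    by (rule measurable_compose[OF measurable_compose[OF measurable_snd measurable_fst]]) simp
  have [measurable]: "q s b a \<in> borel_measurable ?S" for s b a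
    unfolding q_def by measurable
  have [measurable]: "step s b a \<in> borel_measurable ?S" for s b a
    unfolding step_def by measurable
  have s: "(\<lambda>x. samba_leader N (fst x) (snd (snd (snd x)))) \<in> ?S \<rightarrow>\<^sub>M count_space UNIV"
    using measurable_compose[OF _ measurable_samba_leader, of "\<lambda>x. (fst x, snd (snd (snd x)))" ?S N] by simp
  have b: "(\<lambda>x. samba_play N (fst x) (fst (snd (snd x)))) \<in> ?S \<rightarrow>\<^sub>M count_space UNIV"
    using measurable_compose[OF _ measurable_samba_play, of "\<lambda>x. (fst x, fst (snd (snd x)))" ?S N] by simp
  have "(\<lambda>x. step (samba_leader N (fst x) (snd (snd (snd x)))) (samba_play N (fst x) (fst (snd (snd x)))) a x)
      \<in> borel_measurable ?S" for a
    by (rule measurable_compose_countable[OF _ s], rule measurable_compose_countable[OF _ b]) measurable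
  then have "(\<lambda>x a. step (samba_leader N (fst x) (snd (snd (snd x)))) (samba_play N (fst x) (fst (snd (snd x)))) a x)
      \<in> ?S \<rightarrow>\<^sub>M state_space"
    by (intro measurable_PiM_single') (auto simp: space_PiM)
  also have "(\<lambda>x a. step (samba_leader N (fst x) (snd (snd (snd x)))) (samba_play N (fst x) (fst (snd (snd x)))) a x)
      = (\<lambda>(p, w). samba_step \<alpha> N p w)"
    by (auto simp: fun_eq_iff samba_step_def step_def q_def Let_def)
  finally have "(\<lambda>(p, w). samba_step \<alpha> N p w) \<in> ?S \<rightarrow>\<^sub>M state_space" .
  then show ?thesis by (subst measurable_cong_sets) (auto intro!: sets_pair_measure_cong sets_samba_noise)
qed

lemma measurable_samba_p:
  assumes [measurable]: "\<alpha> \<in> borel_measurable borel"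
  shows "(\<lambda>\<omega>. samba_p \<alpha> N p0 \<omega> t) \<in> samba_space N' r \<rightarrow>\<^sub>M state_space"
proof (induction t)
  case (Suc t)
  have "(\<lambda>\<omega>. \<omega> t) \<in> samba_space N' r \<rightarrow>\<^sub>M samba_noise N' r"
    unfolding samba_space_def by measurable
  with Suc have "(\<lambda>\<omega>. (samba_p \<alpha> N p0 \<omega> t, \<omega> t)) \<in> samba_space N' r \<rightarrow>\<^sub>M state_space \<Otimes>\<^sub>M samba_noise N' r"
    by measurable
  from measurable_compose[OF this measurable_samba_step] assms
  show ?case by simp
qed (simp add: space_PiM)

text \<open>Adaptedness: the state at time \<open>i\<close> reads only the noise before
  \<open>i\<close>.\<close>

lemma samba_p_upd: "i \<le> t \<Longrightarrow> samba_p \<alpha> N p0 (fun_upd \<omega> t w) i = samba_p \<alpha> N p0 \<omega> i"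
  by (induction i) auto

lemma samba_space_resample:
  fixes h :: "_ \<Rightarrow> real"
  assumes "integrable (samba_space N r) h"
  shows "(\<integral>\<omega>. h \<omega> \<partial>samba_space N r) = (\<integral>\<omega>. (\<integral>w. h (fun_upd \<omega> t w) \<partial>samba_noise N r) \<partial>samba_space N r)"
    and "integrable (samba_space N r) (\<lambda>\<omega>. \<integral>w. h (fun_upd \<omega> t w) \<partial>samba_noise N r)"
  using prob_space.PiM_resample[OF prob_space_samba_noise, of N r h t] assms
  unfolding samba_space_def by auto

text \<open>The kernel is the law of one step under fresh noise. Resampling the noise at time
  \<open>t\<close> leaves the states up to \<open>t\<close> fixed, so the indicator of the past
  factors out and the kernel remains.\<close>

lemma samba_markov_chain:
  assumes \<alpha>: "\<alpha> \<in> borel_measurable borel"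
  shows "markov_chain (samba_space N r) state_space (\<lambda>t \<omega>. samba_p \<alpha> N p0 \<omega> t)"
proof -
  interpret W: prob_space "samba_noise N r" by (rule prob_space_samba_noise)
  interpret M: prob_space "samba_space N r" by (rule prob_space_samba_space)
  let ?X = "\<lambda>t \<omega>. samba_p \<alpha> N p0 \<omega> t"
  note X[measurable] = measurable_samba_p[OF \<alpha>]
  note step = measurable_samba_step[OF \<alpha>, of N N r]
  have step1: "samba_step \<alpha> N p \<in> samba_noise N r \<rightarrow>\<^sub>M state_space" for p
    using measurable_Pair2[OF step, of p] by (simp add: space_PiM)
  define K where "K = (\<lambda>p. distr (samba_noise N r) state_space (samba_step \<alpha> N p))"
  have K: "K \<in> state_space \<rightarrow>\<^sub>M prob_algebra state_space"
    unfolding K_def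
    by (rule measurable_distr_prob_space2[where M="samba_noise N r"])
      (use W.prob_space_axioms step in \<open>auto simp: space_prob_algebra\<close>)
  show ?thesis
    unfolding markov_chain_def
  proof (intro conjI allI bexI[OF _ K] impI)
    fix t and B :: "nat \<Rightarrow> (nat \<Rightarrow> real) set" and B'
    assume B[measurable]: "\<forall>i\<le>t. B i \<in> sets state_space" and B'[measurable]: "B' \<in> sets state_space"
    define E where "E = {\<omega> \<in> space (samba_space N r). (\<forall>i\<le>t. ?X i \<omega> \<in> B i) \<and> ?X (Suc t) \<omega> \<in> B'}"
    have F[measurable]: "{\<omega> \<in> space (samba_space N r). \<forall>i\<in>{..t}. ?X i \<omega> \<in> B i} \<in> sets (samba_space N r)"
      using B by (intro sets.sets_Collect_finite_All measurable_sets_Collect[OF X]) auto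
    have G: "{\<omega> \<in> space (samba_space N r). ?X (Suc t) \<omega> \<in> B'} \<in> sets (samba_space N r)"
      using X B' by (intro measurable_sets_Collect[OF X]) auto
    have E: "E \<in> sets (samba_space N r)"
      using sets.Int[OF F G] by (simp add: E_def Int_def Ball_def) 
    have "measure (samba_space N r) E = (\<integral>\<omega>. indicator E \<omega> \<partial>samba_space N r)"
      using E by simp
    also have "\<dots> = (\<integral>\<omega>. (\<integral>w. indicator E (fun_upd \<omega> t w) \<partial>samba_noise N r) \<partial>samba_space N r)"
      by (rule samba_space_resample) (use E in \<open>auto simp: M.emeasure_eq_measure\<close>)
    also have "\<dots> = (\<integral>\<omega>. indicator {\<omega> \<in> space (samba_space N r). \<forall>i\<le>t. ?X i \<omega> \<in> B i} \<omega>
         * measure (K (?X t \<omega>)) B' \<partial>samba_space N r)"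
    proof (rule Bochner_Integration.integral_cong[OF refl])
      fix \<omega>
      have "(\<integral>w. (indicator E (fun_upd \<omega> t w) :: real) \<partial>samba_noise N r) =
        (\<integral>w. indicator {\<omega> \<in> space (samba_space N r). \<forall>i\<le>t. ?X i \<omega> \<in> B i} \<omega> *
          indicator (samba_step \<alpha> N (?X t \<omega>) -` B' \<inter> space (samba_noise N r)) w \<partial>samba_noise N r)"
        by (intro Bochner_Integration.integral_cong) (auto simp: E_def indicator_def samba_p_upd)
      also have "\<dots> = indicator {\<omega> \<in> space (samba_space N r). \<forall>i\<le>t. ?X i \<omega> \<in> B i} \<omega> *
          measure (samba_noise N r) (samba_step \<alpha> N (?X t \<omega>) -` B' \<inter> space (samba_noise N r))"
        using measurable_sets[OF step1 B'] by simp
      also have "measure (samba_noise N r) (samba_step \<alpha> N (?X t \<omega>) -` B' \<inter> space (samba_noise N r))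
          = measure (K (?X t \<omega>)) B'"
        unfolding K_def by (rule measure_distr[symmetric, OF step1 B'])
      finally show "(\<integral>w. indicator E (fun_upd \<omega> t w) \<partial>samba_noise N r) =
        indicator {\<omega> \<in> space (samba_space N r). \<forall>i\<le>t. ?X i \<omega> \<in> B i} \<omega> * measure (K (?X t \<omega>)) B'" .
    qed
    finally show "measure (samba_space N r) {\<omega> \<in> space (samba_space N r). (\<forall>i\<le>t. ?X i \<omega> \<in> B i) \<and> ?X (Suc t) \<omega> \<in> B'}
       = (\<integral>\<omega>. indicator {\<omega> \<in> space (samba_space N r). \<forall>i\<le>t. ?X i \<omega> \<in> B i} \<omega>
         * measure (K (?X t \<omega>)) B' \<partial>samba_space N r)" unfolding E_def .
  qed (rule X)
qed

section \<open>One step of the process\<close>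

text \<open>The components from \<open>N\<close> on are fixed at 0 so that a step without reward
  returns the same function, not merely the same first \<open>N\<close> values.\<close>

definition samba_simplex :: "nat \<Rightarrow> (nat \<Rightarrow> real) \<Rightarrow> bool" where
  "samba_simplex N p \<longleftrightarrow> (\<forall>a<N. p a > 0) \<and> (\<Sum>a<N. p a) = 1 \<and> (\<forall>a\<ge>N. p a = 0)"

definition samba_leaders :: "nat \<Rightarrow> (nat \<Rightarrow> real) \<Rightarrow> nat set" where
  "samba_leaders N p = {a. a < N \<and> (\<forall>c<N. p c \<le> p a)}"

text \<open>The next state when \<open>s\<close> leads and the played arm \<open>b\<close> earns a
  reward.\<close>

definition samba_update :: "(real \<Rightarrow> real) \<Rightarrow> nat \<Rightarrow> (nat \<Rightarrow> real) \<Rightarrow> nat \<Rightarrow> nat \<Rightarrow> nat \<Rightarrow> real" where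
  "samba_update \<alpha> N p s b =
     (let q = (\<lambda>a. if a < N \<and> a \<noteq> s then
                 p a + \<alpha> (p a) * (p a)\<^sup>2 * ((if a = b then 1 else 0) / p a - (if s = b then 1 else 0) / p s)
               else 0)
      in q(s := 1 - (\<Sum>a\<in>{..<N} - {s}. q a)))"

lemma samba_simplexD:
  assumes "samba_simplex N p"
  shows "a < N \<Longrightarrow> 0 < p a" "a < N \<Longrightarrow> p a \<le> 1" "(\<Sum>a<N. p a) = 1" "a \<ge> N \<Longrightarrow> p a = 0"
    "s < N \<Longrightarrow> (\<Sum>a\<in>{..<N} - {s}. p a) = 1 - p s"
proof -
  show s: "(\<Sum>a<N. p a) = 1" and "a < N \<Longrightarrow> 0 < p a" "a \<ge> N \<Longrightarrow> p a = 0"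
    using assms by (auto simp: samba_simplex_def)
  have "p a \<le> (\<Sum>a<N. p a)" if "a < N"
    using assms that by (intro member_le_sum) (auto simp: samba_simplex_def less_imp_le)
  then show "a < N \<Longrightarrow> p a \<le> 1" using s by simp
  show "s < N \<Longrightarrow> (\<Sum>a\<in>{..<N} - {s}. p a) = 1 - p s"
    using s by (simp add: sum_diff1)
qed

lemma samba_leader_in_leaders:
  assumes "N > 0"
  shows "samba_leader N p v \<in> samba_leaders N p"
proof -
  let ?A = "samba_leaders N p"
  have fin: "finite ?A" by (simp add: samba_leaders_def)
  have "Max (p ` {..<N}) \<in> p ` {..<N}" using assms by (intro Max_in) auto
  then obtain a where "a < N" "p a = Max (p ` {..<N})" by auto
  then have "a \<in> ?A" by (auto simp: samba_leaders_def)
  \<comment> \<open>A nonempty set of maximisers makes the index, cut off at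
    \<open>card ?A - 1\<close>, valid for every real \<open>v\<close>.\<close>
  then have "card ?A > 0" using fin card_gt_0_iff by blast
  then have "sorted_list_of_set ?A ! min (nat \<lfloor>v * real (card ?A)\<rfloor>) (card ?A - 1) \<in> set (sorted_list_of_set ?A)"
    by (intro nth_mem) auto
  then show ?thesis using fin by (simp add: samba_leader_def Let_def samba_leaders_def)
qed

lemma samba_leaderD:
  assumes "N > 0"
  shows "samba_leader N p v < N"
  using samba_leader_in_leaders[OF assms, of p v] by (auto simp: samba_leaders_def)

lemma samba_play_less: "N > 0 \<Longrightarrow> samba_play N p u < N"
  unfolding samba_play_def by (auto intro: LeastI2)

text \<open>The bracket of the update sees only the reward of the played arm. If that reward is 0,
  no non-leading arm moves, and the leader, being one minus the rest, does not move either.\<close>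

lemma samba_step_eq_update:
  assumes p: "samba_simplex N p" and N: "N > 0"
  shows "samba_step \<alpha> N p (R, u, v) =
    (if R (samba_play N p u) then samba_update \<alpha> N p (samba_leader N p v) (samba_play N p u) else p)"
proof (cases "R (samba_play N p u)")
  case True
  then have "(x = samba_play N p u \<and> R x) = (x = samba_play N p u)" for x by auto
  with True show ?thesis by (simp only: samba_step_def samba_update_def Let_def prod.case if_True)
next
  case False
  let ?s = "samba_leader N p v"
  have s: "?s < N" by (rule samba_leaderD[OF N])
  have b: "(x = samba_play N p u \<and> R x) = False" for x using False by auto
  have "(\<Sum>a\<in>{..<N} - {?s}. if a < N \<and> a \<noteq> ?s then p a else 0) = (\<Sum>a\<in>{..<N} - {?s}. p a)"
    by (intro sum.cong) auto
  also have "\<dots> = 1 - p ?s" by (rule samba_simplexD(5)[OF p s])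
  finally show ?thesis
    using False samba_simplexD(4)[OF p] by (auto simp: samba_step_def b Let_def fun_eq_iff)
qed

section \<open>Joint law of the leader, the played arm and its reward\<close>

lemma (in prob_space) sum_prob_fibres:
  fixes f :: "'a \<Rightarrow> nat"
  assumes f: "f \<in> M \<rightarrow>\<^sub>M count_space UNIV" and "\<And>x. f x < N"
  shows "(\<Sum>b<N. prob {x \<in> space M. f x = b}) = 1"
proof -
  have "(\<Sum>b<N. prob {x \<in> space M. f x = b}) = prob (\<Union>b<N. {x \<in> space M. f x = b})"
    using f by (intro finite_measure_finite_Union[symmetric]) (auto simp: disjoint_family_on_def)
  also have "(\<Union>b<N. {x \<in> space M. f x = b}) = space M" using assms(2) by auto
  finally show ?thesis using prob_space by simp
qed

lemma samba_play_eq: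
  assumes p: "samba_simplex N p" and b: "b < N" and u: "(\<Sum>c<b. p c) \<le> u" "u < (\<Sum>c\<le>b. p c)"
  shows "samba_play N p u = b"
proof -
  have "(LEAST b. b < N \<and> u < (\<Sum>c\<le>b. p c)) = b"
  proof (rule Least_equality)
    fix y assume y: "y < N \<and> u < (\<Sum>c\<le>y. p c)"
    show "b \<le> y"
    proof (rule ccontr)
      assume "\<not> b \<le> y"
      then have "(\<Sum>c\<le>y. p c) \<le> (\<Sum>c<b. p c)"
        using samba_simplexD(1)[OF p] b by (intro sum_mono2) (auto simp: less_imp_le)
      then show False using y u by simp
    qed
  qed (use b u in auto)
  then show ?thesis using b u by (auto simp: samba_play_def)
qed

lemma measurable_samba_play_fixed: "samba_play N p \<in> borel \<rightarrow>\<^sub>M count_space UNIV"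
  using measurable_Pair2[OF measurable_samba_play, of p] by (simp add: space_PiM)

lemma measurable_samba_leader_fixed: "samba_leader N p \<in> borel \<rightarrow>\<^sub>M count_space UNIV"
  using measurable_Pair2[OF measurable_samba_leader, of p] by (simp add: space_PiM)

text \<open>The event contains an interval of length \<open>p b\<close>, so each probability is at
  least \<open>p b\<close>. Both families sum to 1, which leaves no room for a strict
  inequality.\<close>

lemma prob_samba_play:
  assumes p: "samba_simplex N p" and b: "b < N"
  shows "measure (uniform_measure lborel {0..1::real}) {u. samba_play N p u = b} = p b"
proof -
  let ?U = "uniform_measure lborel {0..1::real}"
  interpret U: prob_space ?U by (intro prob_space_uniform_measure) auto
  have N: "N > 0" using b by simp
  have pos: "c < N \<Longrightarrow> 0 \<le> p c" for c using samba_simplexD(1)[OF p] by (simp add: less_imp_le)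
  have meas: "samba_play N p \<in> ?U \<rightarrow>\<^sub>M count_space UNIV"
    using measurable_samba_play_fixed by (simp cong: measurable_cong_sets)
  have sets: "{u. samba_play N p u = b} \<in> sets ?U" for b
    using measurable_sets[OF meas, of "{b}"] by (simp add: vimage_def)
  have ge: "p b \<le> measure ?U {u. samba_play N p u = b}" if b: "b < N" for b
  proof -
    let ?I = "{(\<Sum>c<b. p c)..<(\<Sum>c\<le>b. p c)}"
    have "0 \<le> (\<Sum>c<b. p c)" using pos b by (intro sum_nonneg) auto
    moreover have "(\<Sum>c\<le>b. p c) \<le> (\<Sum>c<N. p c)"
      using pos b by (intro sum_mono2) auto
    ultimately have "?I \<subseteq> {0..1}" using samba_simplexD(3)[OF p] by auto
    then have "{0..1} \<inter> ?I = ?I" by auto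
    moreover have "(\<Sum>c\<le>b. p c) = (\<Sum>c<b. p c) + p b"
      by (simp add: lessThan_Suc_atMost[symmetric])
    ultimately have "p b = measure ?U ?I"
      using samba_simplexD(1)[OF p b] by (subst measure_uniform_measure) auto
    also have "\<dots> \<le> measure ?U {u. samba_play N p u = b}"
      using samba_play_eq[OF p b] sets by (intro U.finite_measure_mono) auto
    finally show ?thesis .
  qed
  have "(\<Sum>b<N. measure ?U {u. samba_play N p u = b} - p b) = 0"
    using U.sum_prob_fibres[OF meas samba_play_less[OF N]] samba_simplexD(3)[OF p]
    by (simp add: sum_subtractf)
  then have "\<forall>b\<in>{..<N}. measure ?U {u. samba_play N p u = b} - p b = 0"
    using ge by (subst (asm) sum_nonneg_eq_0_iff) auto
  then show ?thesis using b by simp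
qed

lemma prob_bernoulli_family:
  fixes N a :: nat
  assumes "a < N" "r a \<in> {0..1}"
  shows "measure_pmf.prob (Pi_pmf {..<N} False (\<lambda>a. bernoulli_pmf (r a))) {R. R a} = r a"
    "measure_pmf.prob (Pi_pmf {..<N} False (\<lambda>a. bernoulli_pmf (r a))) {R. \<not> R a} = 1 - r a"
proof -
  let ?P = "Pi_pmf {..<N} False (\<lambda>a. bernoulli_pmf (r a))"
  have "map_pmf (\<lambda>R. R a) ?P = bernoulli_pmf (r a)"
    using Pi_pmf_component[where A="{..<N}" and x=a and dflt=False and p="\<lambda>a. bernoulli_pmf (r a)", OF finite_lessThan]
      assms(1) by simp
  then have *: "measure_pmf.prob ?P ((\<lambda>R. R a) -` {x}) = pmf (bernoulli_pmf (r a)) x" for x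
    by (metis measure_map_pmf measure_pmf_single)
  show "measure_pmf.prob ?P {R. R a} = r a" "measure_pmf.prob ?P {R. \<not> R a} = 1 - r a"
    using *[of True] *[of False] assms by (simp_all add: vimage_def)
qed

lemma (in finite_measure) measure_pair_times:
  assumes "A \<in> sets N" "B \<in> sets M"
  shows "measure (N \<Otimes>\<^sub>M M) (A \<times> B) = measure N A * measure M B"
  using assms by (simp add: measure_def emeasure_pair_measure_Times enn2real_mult)

lemma prob_samba_noise_times:
  assumes "B \<in> sets borel" "C \<in> sets borel"
  shows "measure (samba_noise N r) (A \<times> B \<times> C) =
    measure_pmf.prob (Pi_pmf {..<N} False (\<lambda>a. bernoulli_pmf (r a))) A *
      (measure (uniform_measure lborel {0..1}) B * measure (uniform_measure lborel {0..1}) C)"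
proof -
  interpret U: prob_space "uniform_measure lborel {0..1::real}"
    by (intro prob_space_uniform_measure) auto
  interpret UU: pair_prob_space "uniform_measure lborel {0..1::real}" "uniform_measure lborel {0..1::real}" ..
  show ?thesis
    unfolding samba_noise_def using assms
    by (subst UU.P.measure_pair_times, simp, simp, subst U.measure_pair_times) auto
qed

text \<open>The integrand depends on the noise only through the leader, the played arm and the
  reward of that arm. The level sets are boxes, so independence of the three noise components
  factors their probabilities.\<close>

lemma samba_noise_integral:
  fixes g :: "nat \<Rightarrow> nat \<Rightarrow> bool \<Rightarrow> real"
  assumes p: "samba_simplex N p" and r: "\<forall>a<N. r a \<in> {0..1}" and N: "N > 0"
  shows "(\<integral>w. g (samba_leader N p (snd (snd w))) (samba_play N p (fst (snd w)))
            (fst w (samba_play N p (fst (snd w)))) \<partial>samba_noise N r)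
    = (\<Sum>s<N. measure (uniform_measure lborel {0..1}) {v. samba_leader N p v = s} *
         (\<Sum>b<N. p b * (r b * g s b True + (1 - r b) * g s b False)))" (is "?L = ?R")
proof -
  interpret W: prob_space "samba_noise N r" by (rule prob_space_samba_noise)
  let ?m = "\<lambda>s. measure (uniform_measure lborel {0..1}) {v. samba_leader N p v = s}"
  let ?Q = "\<lambda>s b (x::bool). {R. R b = x} \<times> {u. samba_play N p u = b} \<times> {v. samba_leader N p v = s}"
  have B: "{u. samba_play N p u = b} \<in> sets borel" for b
    using measurable_sets[OF measurable_samba_play_fixed, of "{b}" N p] by (simp add: vimage_def)
  have C: "{v. samba_leader N p v = s} \<in> sets borel" for s
    using measurable_sets[OF measurable_samba_leader_fixed, of "{s}" N p] by (simp add: vimage_def)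
  have Q: "?Q s b x \<in> sets (samba_noise N r)" for s b x
    unfolding sets_samba_noise using B C by (intro pair_measureI) auto
  have meas: "measure (samba_noise N r) (?Q s b True) = r b * (p b * ?m s)"
    "measure (samba_noise N r) (?Q s b False) = (1 - r b) * (p b * ?m s)" if "b < N" for s b
    using prob_samba_noise_times[OF B C, of N r] prob_samba_play[OF p that] prob_bernoulli_family[OF that] r that
    by auto
  have "?L = (\<integral>w. (\<Sum>s<N. \<Sum>b<N. g s b True * indicator (?Q s b True) w
      + g s b False * indicator (?Q s b False) w) \<partial>samba_noise N r)"
  proof (rule Bochner_Integration.integral_cong[OF refl])
    fix w :: "(nat \<Rightarrow> bool) \<times> real \<times> real"
    obtain R u v where w: "w = (R, u, v)" by (cases w)
    let ?s = "samba_leader N p v" and ?b = "samba_play N p u"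
    have "(\<Sum>s<N. \<Sum>b<N. g s b True * indicator (?Q s b True) w + g s b False * indicator (?Q s b False) w)
      = (\<Sum>s<N. \<Sum>b<N. if b = ?b then (if s = ?s then g ?s ?b (R ?b) else 0) else 0)"
      by (intro sum.cong) (auto simp: w indicator_def)
    also have "\<dots> = g ?s ?b (R ?b)"
      using samba_play_less[OF N, of p u] samba_leaderD[OF N, of p v] by (simp add: sum.delta)
    finally show "g (samba_leader N p (snd (snd w))) (samba_play N p (fst (snd w)))
        (fst w (samba_play N p (fst (snd w)))) = (\<Sum>s<N. \<Sum>b<N. g s b True * indicator (?Q s b True) w
        + g s b False * indicator (?Q s b False) w)"
      by (simp add: w)
  qed
  also have "\<dots> = (\<Sum>s<N. \<Sum>b<N. g s b True * measure (samba_noise N r) (?Q s b True)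
      + g s b False * measure (samba_noise N r) (?Q s b False))"
    by (intro has_bochner_integral_integral_eq has_bochner_integral_sum has_bochner_integral_add
      has_bochner_integral_mult_right has_bochner_integral_real_indicator Q)
      (auto simp: W.emeasure_eq_measure)
  also have "\<dots> = ?R"
    unfolding sum_distrib_left
    by (intro sum.cong refl) (simp only: lessThan_iff meas, simp add: algebra_simps)
  finally show ?thesis .
qed

text \<open>A bound that holds for every possible leader survives the tie-breaking, because the
  probabilities of the leaders sum to 1. Indices that are not maximisers have probability 0.\<close>

lemma samba_noise_integral_le:
  fixes g :: "nat \<Rightarrow> nat \<Rightarrow> bool \<Rightarrow> real"
  assumes p: "samba_simplex N p" and r: "\<forall>a<N. r a \<in> {0..1}" and N: "N > 0"
    and le: "\<And>s. s \<in> samba_leaders N p \<Longrightarrow>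
      (\<Sum>b<N. p b * (r b * g s b True + (1 - r b) * g s b False)) \<le> c"
  shows "(\<integral>w. g (samba_leader N p (snd (snd w))) (samba_play N p (fst (snd w)))
            (fst w (samba_play N p (fst (snd w)))) \<partial>samba_noise N r) \<le> c"
proof -
  let ?U = "uniform_measure lborel {0..1::real}"
  let ?m = "\<lambda>s. measure ?U {v. samba_leader N p v = s}"
  interpret U: prob_space ?U by (intro prob_space_uniform_measure) auto
  have meas: "samba_leader N p \<in> ?U \<rightarrow>\<^sub>M count_space UNIV"
    using measurable_samba_leader_fixed by (simp cong: measurable_cong_sets)
  have "?m s * (\<Sum>b<N. p b * (r b * g s b True + (1 - r b) * g s b False)) \<le> ?m s * c" for s
  proof (cases "s \<in> samba_leaders N p")
    case True then show ?thesis by (intro mult_left_mono le) auto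
  next
    case False
    then have "{v. samba_leader N p v = s} = {}" using samba_leader_in_leaders[OF N, of p] by auto
    then show ?thesis by simp
  qed
  then have "(\<Sum>s<N. ?m s * (\<Sum>b<N. p b * (r b * g s b True + (1 - r b) * g s b False))) \<le> (\<Sum>s<N. ?m s * c)"
    by (intro sum_mono)
  also have "\<dots> = c"
    using U.sum_prob_fibres[OF meas samba_leaderD[OF N]] by (simp add: sum_distrib_right[symmetric])
  finally show ?thesis by (simp add: samba_noise_integral[OF p r N])
qed

text \<open>A play without reward keeps the value \<open>f p\<close>, so only rewarded increments
  remain in the condition on \<open>c\<close>.\<close>

lemma samba_step_integral_le:
  fixes f :: "(nat \<Rightarrow> real) \<Rightarrow> real"
  assumes p: "samba_simplex N p" and r: "\<forall>a<N. r a \<in> {0..1}" and N: "N > 0"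
    and le: "\<And>s. s \<in> samba_leaders N p \<Longrightarrow>
      (\<Sum>b<N. p b * r b * (f (samba_update \<alpha> N p s b) - f p)) \<le> c"
  shows "(\<integral>w. f (samba_step \<alpha> N p w) \<partial>samba_noise N r) \<le> f p + c"
proof -
  let ?g = "\<lambda>s b x. if x then f (samba_update \<alpha> N p s b) else f p"
  have "f (samba_step \<alpha> N p w) = ?g (samba_leader N p (snd (snd w))) (samba_play N p (fst (snd w)))
            (fst w (samba_play N p (fst (snd w))))" for w
    using samba_step_eq_update[OF p N, of \<alpha> "fst w" "fst (snd w)" "snd (snd w)"] by simp
  moreover have "(\<integral>w. ?g (samba_leader N p (snd (snd w))) (samba_play N p (fst (snd w)))
            (fst w (samba_play N p (fst (snd w)))) \<partial>samba_noise N r) \<le> f p + c"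
  proof (rule samba_noise_integral_le[OF p r N])
    fix s assume s: "s \<in> samba_leaders N p"
    have "(\<Sum>b<N. p b * (r b * ?g s b True + (1 - r b) * ?g s b False))
      = (\<Sum>b<N. p b * r b * (f (samba_update \<alpha> N p s b) - f p)) + (\<Sum>b<N. p b) * f p"
      unfolding sum_distrib_right sum.distrib[symmetric] by (intro sum.cong) (auto simp: algebra_simps)
    then show "(\<Sum>b<N. p b * (r b * ?g s b True + (1 - r b) * ?g s b False)) \<le> f p + c"
      using le[OF s] samba_simplexD(3)[OF p] by simp
  qed
  ultimately show ?thesis by simp
qed

section \<open>Coordinates of a rewarded update\<close>

lemma samba_update_other:
  assumes p: "samba_simplex N p" and "a < N" "a \<noteq> s"
  shows "samba_update \<alpha> N p s b a =
    (if b = a then p a + \<alpha> (p a) * p a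
     else if b = s then p a - \<alpha> (p a) * (p a)\<^sup>2 / p s else p a)"
  using samba_simplexD(1)[OF p assms(2)] assms(2,3) unfolding samba_update_def Let_def
  by (auto simp: power2_eq_square right_diff_distrib)

lemma samba_update_self:
  "samba_update \<alpha> N p s b s = 1 - (\<Sum>a\<in>{..<N} - {s}. samba_update \<alpha> N p s b a)"
  by (simp add: samba_update_def Let_def)

lemma samba_update_out: "a \<ge> N \<Longrightarrow> s < N \<Longrightarrow> samba_update \<alpha> N p s b a = 0"
  by (simp add: samba_update_def Let_def)

lemma sum_samba_update:
  assumes "s < N" shows "(\<Sum>a<N. samba_update \<alpha> N p s b a) = 1"
  using assms by (simp add: sum.remove[of "{..<N}" s] samba_update_self[of \<alpha> N p s b])

text \<open>Among the other arms only \<open>b\<close> gains and none loses, so the leader pays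
  exactly that gain.\<close>

lemma samba_update_self_ne:
  assumes p: "samba_simplex N p" and s: "s < N" and b: "b < N" "b \<noteq> s"
  shows "samba_update \<alpha> N p s b s = p s - \<alpha> (p b) * p b"
proof -
  have "(\<Sum>a\<in>{..<N} - {s}. samba_update \<alpha> N p s b a)
      = (\<Sum>a\<in>{..<N} - {s}. p a + (if a = b then \<alpha> (p b) * p b else 0))"
    by (intro sum.cong) (use b in \<open>auto simp: samba_update_other[OF p]\<close>)
  also have "\<dots> = 1 - p s + \<alpha> (p b) * p b"
    using b by (simp add: sum.distrib samba_simplexD(5)[OF p s] sum.delta)
  finally show ?thesis by (simp add: samba_update_self)
qed

section \<open>Abstract learning rate and bounds for a single update\<close>

locale samba =
  fixes \<alpha> :: "real \<Rightarrow> real" and N :: nat and r p0 :: "nat \<Rightarrow> real" and astar :: nat and \<Delta> :: real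
  assumes \<alpha>_measurable: "\<alpha> \<in> borel_measurable borel"
    and \<alpha>_pos: "0 < x \<Longrightarrow> x \<le> 1 \<Longrightarrow> 0 < \<alpha> x"
    and \<alpha>_le_half: "0 < x \<Longrightarrow> x \<le> 1 \<Longrightarrow> \<alpha> x \<le> 1/2"
    and \<alpha>_mono: "0 < x \<Longrightarrow> x \<le> y \<Longrightarrow> y \<le> 1 \<Longrightarrow> \<alpha> x \<le> \<alpha> y"
    and \<alpha>_lim: "(\<alpha> \<longlongrightarrow> 0) (at_right 0)"
    and N: "N \<ge> 2"
    and astar: "astar < N"
    and r_range: "\<forall>a<N. r a \<in> {0..1}"
    and \<Delta>_pos: "\<Delta> > 0"
    and gap: "a < N \<Longrightarrow> a \<noteq> astar \<Longrightarrow> r a + \<Delta> \<le> r astar"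
    and p0: "samba_simplex N p0"
begin

abbreviation "upd \<equiv> samba_update \<alpha> N"

definition G :: "real \<Rightarrow> real" where "G x = \<alpha> x * x\<^sup>2"

text \<open>The conditional expected increment of \<open>f\<close> when \<open>s\<close> is the leader of \<open>p\<close>.\<close>
definition drift :: "((nat \<Rightarrow> real) \<Rightarrow> real) \<Rightarrow> (nat \<Rightarrow> real) \<Rightarrow> nat \<Rightarrow> real" where
  "drift f p s = (\<Sum>b<N. p b * r b * (f (upd p s b) - f p))"

lemma N_pos: "N > 0" using N by simp

lemma r_bounds: "a < N \<Longrightarrow> 0 \<le> r a" "a < N \<Longrightarrow> r a \<le> 1"
  using r_range by auto

lemma \<Delta>_le_1: "\<Delta> \<le> 1"
proof -
  obtain a where "a < N" "a \<noteq> astar"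
    using N by (cases "astar = 0") (auto intro: that[of 1] that[of 0])
  then show ?thesis using gap[of a] r_bounds(1)[of a] r_bounds(2)[of astar] astar by linarith
qed

lemma G_nonneg: "0 < x \<Longrightarrow> x \<le> 1 \<Longrightarrow> 0 \<le> G x"
  using \<alpha>_pos[of x] by (simp add: G_def)

lemma G_pos: "0 < x \<Longrightarrow> x \<le> 1 \<Longrightarrow> 0 < G x"
  using \<alpha>_pos[of x] by (simp add: G_def)

lemma G_mono: "0 < x \<Longrightarrow> x \<le> y \<Longrightarrow> y \<le> 1 \<Longrightarrow> G x \<le> G y"
  unfolding G_def using \<alpha>_pos[of y] by (intro mult_mono \<alpha>_mono power_mono) auto

context
  fixes p assumes p: "samba_simplex N p"
begin

lemma leader_less: "s \<in> samba_leaders N p \<Longrightarrow> s < N"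
  and le_leader: "s \<in> samba_leaders N p \<Longrightarrow> a < N \<Longrightarrow> p a \<le> p s"
  by (auto simp: samba_leaders_def)

lemmas p_simplex = samba_simplexD[OF p]

lemma \<alpha>_state: "a < N \<Longrightarrow> 0 < \<alpha> (p a)" "a < N \<Longrightarrow> \<alpha> (p a) \<le> 1/2"
  using \<alpha>_pos \<alpha>_le_half p_simplex(1,2) by auto

lemma leader_ge:
  assumes "s \<in> samba_leaders N p" shows "1 \<le> real N * p s"
proof -
  have "(\<Sum>a<N. p a) \<le> (\<Sum>a<N. p s)" using assms le_leader by (intro sum_mono) auto
  then show ?thesis using p_simplex(3) by simp
qed

text \<open>The leader dominates, so \<open>p a / p s \<le> 1\<close>; the remaining factor is
  controlled by \<open>\<alpha> \<le> 1/2\<close>.\<close>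

lemma loss_le:
  assumes s: "s \<in> samba_leaders N p" and a: "a < N"
  shows "\<alpha> (p a) * (p a)\<^sup>2 / p s \<le> p a / 2" "0 \<le> \<alpha> (p a) * (p a)\<^sup>2 / p s"
proof -
  have ps: "0 < p s" "p a \<le> p s" "0 < p a" using s a leader_less le_leader p_simplex(1) by auto
  have "\<alpha> (p a) * (p a)\<^sup>2 / p s = \<alpha> (p a) * p a * (p a / p s)" by (simp add: power2_eq_square)
  also have "\<dots> \<le> 1/2 * p a * 1"
    using \<alpha>_state[OF a] ps by (intro mult_mono) auto
  finally show "\<alpha> (p a) * (p a)\<^sup>2 / p s \<le> p a / 2" by simp
  show "0 \<le> \<alpha> (p a) * (p a)\<^sup>2 / p s" using \<alpha>_state[OF a] ps by simp
qed

lemma gain_le: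
  assumes a: "a < N"
  shows "\<alpha> (p a) * p a \<le> p a / 2" "0 \<le> \<alpha> (p a) * p a"
  using mult_right_mono[OF \<alpha>_state(2)[OF a], of "p a"] \<alpha>_state(1)[OF a] p_simplex(1)[OF a] by auto

lemma upd_self_ge:
  assumes s: "s \<in> samba_leaders N p"
  shows "p s \<le> upd p s s s"
proof -
  have "(\<Sum>a\<in>{..<N} - {s}. upd p s s a) \<le> (\<Sum>a\<in>{..<N} - {s}. p a)"
    using loss_le(2)[OF s] by (intro sum_mono) (auto simp: samba_update_other[OF p])
  then show ?thesis using p_simplex(5)[OF leader_less[OF s]] by (simp add: samba_update_self)
qed

text \<open>A non-leader loses at most half of itself. The leader pays for the gain of
  \<open>b\<close>, at most \<open>p b / 2\<close>, and \<open>p b\<close> is no larger than its own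
  mass. Hence positivity of the coordinates is preserved.\<close>

lemma upd_ge_half:
  assumes s: "s \<in> samba_leaders N p" and a: "a < N" and b: "b < N"
  shows "p a / 2 \<le> upd p s b a"
proof (cases "a = s")
  case False
  then show ?thesis
    using loss_le[OF s a] gain_le[OF a] p_simplex(1)[OF a] a
    by (auto simp: samba_update_other[OF p])
next
  case True
  show ?thesis
  proof (cases "b = s")
    case True
    then show ?thesis using upd_self_ge[OF s] \<open>a = s\<close> p_simplex(1)[OF a] by simp
  next
    case False
    then show ?thesis
      using samba_update_self_ne[OF p leader_less[OF s] b False] gain_le[OF b] le_leader[OF s b] \<open>a = s\<close>
      by simp
  qed
qed

lemma upd_simplex:
  assumes s: "s \<in> samba_leaders N p" and b: "b < N"
  shows "samba_simplex N (upd p s b)"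
  unfolding samba_simplex_def
proof (intro conjI allI impI)
  fix a assume a: "a < N"
  show "0 < upd p s b a" using upd_ge_half[OF s a b] p_simplex(1)[OF a] by linarith
qed (use leader_less[OF s] in \<open>auto simp: sum_samba_update samba_update_out\<close>)

lemma upd_other_le:
  assumes s: "s \<in> samba_leaders N p" and a: "a < N" "a \<noteq> s"
  shows "upd p s b a \<le> 3/2 * p a"
  using loss_le[OF s a(1)] gain_le[OF a(1)] p_simplex(1)[OF a(1)] a
  by (auto simp: samba_update_other[OF p])

text \<open>A non-leader grows by at most half of itself. The leader cannot exceed 1 and already
  holds at least \<open>1 / N\<close>.\<close>

lemma upd_increment_le:
  assumes s: "s \<in> samba_leaders N p" and a: "a < N" and b: "b < N"
  shows "upd p s b a - p a \<le> real N * p a"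
proof (cases "a = s")
  case False
  have "p a \<le> real N * p a" using N p_simplex(1)[OF a] by simp
  then show ?thesis using upd_other_le[OF s a False, of b] p_simplex(1)[OF a] by linarith
next
  case True
  have "upd p s b a \<le> 1" using samba_simplexD(2)[OF upd_simplex[OF s b] a] .
  then show ?thesis using leader_ge[OF s] p_simplex(1)[OF a] unfolding True by linarith
qed

section \<open>Drift of the coordinates and of the inverse optimal mass\<close>

lemma drift_other:
  assumes s: "s \<in> samba_leaders N p" and a: "a < N" "a \<noteq> s"
  shows "drift (\<lambda>q. f (q a)) p s =
    p a * r a * (f (p a + \<alpha> (p a) * p a) - f (p a))
    + p s * r s * (f (p a - \<alpha> (p a) * (p a)\<^sup>2 / p s) - f (p a))" (is "_ = ?A + ?B")
proof -
  have "drift (\<lambda>q. f (q a)) p s = (\<Sum>b<N. (if b = a then ?A else 0) + (if b = s then ?B else 0))"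
    unfolding drift_def using a by (intro sum.cong) (auto simp: samba_update_other[OF p])
  also have "\<dots> = ?A + ?B"
    using a leader_less[OF s] by (simp add: sum.distrib sum.delta)
  finally show ?thesis .
qed

lemma drift_coord_other:
  assumes s: "s \<in> samba_leaders N p" and a: "a < N" "a \<noteq> s"
  shows "drift (\<lambda>q. q a) p s = G (p a) * (r a - r s)"
proof -
  have "p s > 0" using p_simplex(1) leader_less[OF s] .
  then show ?thesis
    using drift_other[OF assms, of "\<lambda>x. x"] by (simp add: G_def power2_eq_square algebra_simps)
qed

lemma drift_sum: "drift (\<lambda>q. \<Sum>a\<in>A. f a q) p s = (\<Sum>a\<in>A. drift (f a) p s)"
  unfolding drift_def by (subst sum.swap) (simp add: sum_subtractf[symmetric] sum_distrib_left)

lemma drift_uminus: "drift (\<lambda>q. - f q) p s = - drift f p s"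
  unfolding drift_def by (simp add: sum_negf[symmetric] algebra_simps)

text \<open>Total mass is conserved, so the drift of the leader balances the drifts of all other
  arms.\<close>

lemma drift_coord_leader:
  assumes s: "s \<in> samba_leaders N p"
  shows "drift (\<lambda>q. q s) p s = (\<Sum>c\<in>{..<N} - {s}. G (p c) * (r s - r c))"
proof -
  have "drift (\<lambda>q. q s) p s = drift (\<lambda>q. - (\<Sum>c\<in>{..<N} - {s}. q c)) p s"
    unfolding drift_def using p_simplex(5)[OF leader_less[OF s]]
    by (intro sum.cong) (auto simp: samba_update_self)
  also have "\<dots> = - (\<Sum>c\<in>{..<N} - {s}. G (p c) * (r c - r s))"
    using s by (simp add: drift_uminus drift_sum drift_coord_other)
  finally show ?thesis by (simp add: sum_negf[symmetric] algebra_simps)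
qed

lemma astar_bounds: "0 < p astar" "p astar < 1"
proof -
  show "0 < p astar" using p_simplex(1)[OF astar] .
  obtain a where a: "a < N" "a \<noteq> astar"
    using N by (cases "astar = 0") (auto intro: that[of 1] that[of 0])
  then have "0 < (\<Sum>c\<in>{..<N} - {astar}. p c)"
    using p_simplex(1) by (intro sum_pos) auto
  then show "p astar < 1" using p_simplex(5)[OF astar] by simp
qed

text \<open>If the optimal arm does not lead, its own drift is at least
  \<open>\<Delta> * G (p astar)\<close>. If it leads, some competitor holds at least
  \<open>(1 - p astar) / N\<close>, and its term alone suffices as all terms are nonnegative. The
  minimum covers both cases; the sign fits the upper bounds for expectations.\<close>

lemma drift_neg_astar_le:
  assumes s: "s \<in> samba_leaders N p"
  shows "drift (\<lambda>q. - q astar) p s \<le> - (\<Delta> * G (min (p astar) (1 - p astar) / N))"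
proof -
  let ?m = "min (p astar) (1 - p astar) / N"
  have "?m \<le> min (p astar) (1 - p astar) / 1"
    using astar_bounds N by (intro divide_left_mono) auto
  then have m: "0 < ?m" "?m \<le> p astar" "?m \<le> (1 - p astar) / N"
    using astar_bounds N by (auto simp: divide_right_mono)
  have "\<Delta> * G ?m \<le> drift (\<lambda>q. q astar) p s"
  proof (cases "s = astar")
    case False
    have "\<Delta> * G ?m \<le> G (p astar) * (r astar - r s)"
      unfolding mult.commute[of \<Delta>]
      using G_mono[OF m(1,2)] astar_bounds gap[of s] False leader_less[OF s] \<Delta>_pos G_nonneg[OF m(1)] m(2)
      by (intro mult_mono) (auto intro: G_nonneg)
    then show ?thesis using drift_coord_other[OF s astar] False by simp
  next
    case True
    \<comment> \<open>The \<open>N - 1\<close> competitors share the mass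
      \<open>1 - p astar\<close>, so they cannot all stay below
      \<open>(1 - p astar) / N\<close>.\<close>
    have "\<exists>c\<in>{..<N} - {astar}. (1 - p astar) / N \<le> p c"
    proof (rule ccontr)
      assume "\<not> ?thesis"
      then have "(\<Sum>c\<in>{..<N} - {astar}. p c) \<le> (\<Sum>c\<in>{..<N} - {astar}. (1 - p astar) / N)"
        by (intro sum_mono) (meson linear)
      also have "\<dots> = (1 - p astar) * (real (N - 1) / N)"
        using astar by simp
      also have "\<dots> < (1 - p astar) * 1"
        using astar_bounds N by (intro mult_strict_left_mono) auto
      finally show False using p_simplex(5)[OF astar] by simp
    qed
    then obtain c where c: "c < N" "c \<noteq> astar" "(1 - p astar) / N \<le> p c" by auto
    have "\<Delta> * G ?m \<le> G (p c) * (r astar - r c)"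
      unfolding mult.commute[of \<Delta>]
      using G_mono[of ?m "p c"] m c p_simplex(1,2)[OF c(1)] gap[OF c(1,2)] \<Delta>_pos
      by (intro mult_mono) (auto intro: G_nonneg)
    also have "\<dots> \<le> (\<Sum>c\<in>{..<N} - {astar}. G (p c) * (r astar - r c))"
      using c gap \<Delta>_pos p_simplex(1,2) 
      by (intro member_le_sum mult_nonneg_nonneg G_nonneg) (auto, smt (verit))
    also have "\<dots> = drift (\<lambda>q. q astar) p s"
      using drift_coord_leader[OF s] True by simp
    finally show ?thesis .
  qed
  then show ?thesis by (simp add: drift_uminus)
qed

text \<open>With \<open>a = \<alpha> (p astar)\<close>, rewards of the optimal arm lower the inverse
  by \<open>r astar * a / (1 + a)\<close> on average, and rewards of the leader raise it by at most
  \<open>r s * a / (1 - a)\<close>. The condition \<open>2 * a \<le> \<Delta>\<close> makes the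
  first dominate.\<close>

lemma drift_inverse_le:
  assumes s: "s \<in> samba_leaders N p" and small: "p astar < 1 / N" "\<alpha> (p astar) \<le> \<Delta> / 2"
  shows "drift (\<lambda>q. 1 / q astar) p s \<le> 0"
proof -
  let ?q = "p astar"
  define a where "a = \<alpha> ?q"
  \<comment> \<open>A leader has mass at least \<open>1 / N\<close>, which the optimal arm does not
    reach here.\<close>
  have sa: "astar \<noteq> s" using leader_ge[OF s] small(1) N by (auto simp: field_simps)
  have sN: "s < N" by (rule leader_less[OF s])
  have q: "0 < ?q" "?q \<le> p s" "0 < p s" using astar_bounds le_leader[OF s astar] by auto
  have a: "0 < a" "a \<le> 1/2" "a \<le> \<Delta> / 2" using \<alpha>_state[OF astar] small by (auto simp: a_def)
  \<comment> \<open>\<open>y\<close> is the fraction of its mass that the optimal arm loses when the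
    leader is rewarded.\<close>
  define y where "y = a * ?q / p s"
  have y: "0 \<le> y" "y \<le> a"
    using q a mult_left_mono[of "?q / p s" 1 a] by (auto simp: y_def)
  have 1: "?q * r astar * (1 / (?q + a * ?q) - 1 / ?q) = - (r astar * a / (1 + a))"
  proof -
    define z where "z = 1 + a"
    have "?q + a * ?q = ?q * z" "z > 0" "a = z - 1" using a by (auto simp: z_def algebra_simps)
    moreover have "?q * r astar * (1 / (?q * z) - 1 / ?q) = - (r astar * (z - 1) / z)" if "z > 0"
      using q that by (simp add: field_simps)
    ultimately show ?thesis by simp
  qed
  define z where "z = 1 - y"
  have z: "z > 0" using a y by (simp add: z_def)
  have "?q - a * ?q\<^sup>2 / p s = ?q * z" by (simp add: z_def y_def power2_eq_square algebra_simps)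
  then have "p s * r s * (1 / (?q - a * ?q\<^sup>2 / p s) - 1 / ?q) = p s * r s * (1 / (?q * z) - 1 / ?q)"
    by simp
  also have "\<dots> = p s * r s * ((1 - z) / ?q) / z"
    using q z by (simp add: field_simps)
  also have "\<dots> = p s * r s * (y / ?q) / (1 - y)" by (simp add: z_def)
  also have "y / ?q = a / p s" using q by (simp add: y_def)
  also have "p s * r s * (a / p s) / (1 - y) = r s * a / (1 - y)" using q by simp
  also have "\<dots> \<le> r s * a / (1 - a)"
    using y a r_bounds[OF sN] by (intro divide_left_mono) auto
  finally have 2: "p s * r s * (1 / (?q - a * ?q\<^sup>2 / p s) - 1 / ?q) \<le> r s * a / (1 - a)" .
  \<comment> \<open>The two extra terms cost at most \<open>a\<close> each, and the gap pays for
    \<open>2 * a\<close>.\<close>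
  have "r s * (1 + a) \<le> r astar * (1 - a)"
  proof -
    have "r s * a \<le> a" "r astar * a \<le> a"
      using r_bounds[OF sN] r_bounds[OF astar] a by (auto simp: mult_le_cancel_right1)
    then have "r s + r s * a \<le> r astar - r astar * a" using gap[OF sN] sa a by linarith
    then show ?thesis by (simp add: distrib_left right_diff_distrib)
  qed
  then have "r s / (1 - a) \<le> r astar / (1 + a)" using a by (simp add: field_simps)
  from mult_left_mono[OF this, of a] have "r s * a / (1 - a) \<le> r astar * a / (1 + a)"
    using a by (simp add: mult.commute)
  then show ?thesis
    using drift_other[OF s astar sa, of "\<lambda>x. 1 / x"] 1 2 by (simp add: a_def)
qed

end

section \<open>Drift of the logarithmic potential\<close>

lemma ln_tangent:
  fixes x y \<epsilon> :: real
  assumes "0 < x + \<epsilon>" "0 < y + \<epsilon>"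
  shows "ln (y + \<epsilon>) - ln (x + \<epsilon>) \<le> (y - x) / (x + \<epsilon>)"
proof -
  have "ln (y + \<epsilon>) - ln (x + \<epsilon>) = ln ((y + \<epsilon>) / (x + \<epsilon>))" using assms by (simp add: ln_div)
  also have "\<dots> \<le> (y + \<epsilon>) / (x + \<epsilon>) - 1" using assms by (intro ln_le_minus_one) auto
  also have "\<dots> = (y - x) / (x + \<epsilon>)" using assms by (simp add: field_simps)
  finally show ?thesis .
qed

text \<open>The shift by \<open>\<epsilon>\<close> keeps every logarithm above
  \<open>ln \<epsilon>\<close>, which bounds the total decrease of the potential.\<close>

definition \<Phi> :: "real \<Rightarrow> (nat \<Rightarrow> real) \<Rightarrow> real" where
  "\<Phi> \<epsilon> p = (\<Sum>a\<in>{..<N} - {astar}. ln (p a + \<epsilon>))"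

text \<open>More than half of the mass forces the optimal arm to lead. Concavity of the logarithm
  bounds the drift of each term by the coordinate drift divided by \<open>p a + \<epsilon>\<close>,
  and the reward gap then gives the factor \<open>- \<Delta>\<close>.\<close>

lemma drift_log_potential_le:
  assumes p: "samba_simplex N p" and s: "s \<in> samba_leaders N p" and \<epsilon>: "\<epsilon> > 0"
    and q: "p astar > 1/2"
  shows "drift (\<Phi> \<epsilon>) p s \<le> - (\<Delta> * (\<Sum>a\<in>{..<N} - {astar}. G (p a) / (p a + \<epsilon>)))"
proof -
  note ps = samba_simplexD[OF p]
  have sN: "s < N" by (rule leader_less[OF p s])
  have "s = astar"
  proof (rule ccontr)
    assume "s \<noteq> astar"
    then have "p s \<le> (\<Sum>c\<in>{..<N} - {astar}. p c)"
      using sN ps(1) by (intro member_le_sum) (auto intro: less_imp_le)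
    then show False using ps(5)[OF astar] q le_leader[OF p s astar] by simp
  qed
  have "drift (\<lambda>q. ln (q a + \<epsilon>)) p s \<le> - (\<Delta> * (G (p a) / (p a + \<epsilon>)))" if a: "a \<in> {..<N} - {astar}" for a
  proof -
    have aN: "a < N" and as: "a \<noteq> s" using a \<open>s = astar\<close> by auto
    let ?d = "p a + \<epsilon>"
    have d: "?d > 0" using ps(1)[OF aN] \<epsilon> by simp
    have "drift (\<lambda>q. ln (q a + \<epsilon>)) p s =
        p a * r a * (ln (p a + \<alpha> (p a) * p a + \<epsilon>) - ln ?d)
        + p s * r s * (ln (p a - \<alpha> (p a) * (p a)\<^sup>2 / p s + \<epsilon>) - ln ?d)"
      using drift_other[OF p s aN as, of "\<lambda>x. ln (x + \<epsilon>)"] .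
    also have "\<dots> \<le> p a * r a * ((p a + \<alpha> (p a) * p a - p a) / ?d)
        + p s * r s * ((p a - \<alpha> (p a) * (p a)\<^sup>2 / p s - p a) / ?d)"
      using gain_le[OF p aN] loss_le[OF p s aN] ps(1)[OF aN] ps(1)[OF sN] r_bounds aN sN \<epsilon>
      by (intro add_mono mult_left_mono ln_tangent) auto
    also have "\<dots> = G (p a) / ?d * (r a - r s)"
    proof -
      have "p s * r s * ((p a - \<alpha> (p a) * (p a)\<^sup>2 / p s - p a) / ?d) = - (r s * G (p a) / ?d)"
        using ps(1)[OF sN] by (simp add: G_def)
      then show ?thesis by (simp add: G_def power2_eq_square right_diff_distrib diff_divide_distrib mult_ac)
    qed
    also have "\<dots> \<le> G (p a) / ?d * (- \<Delta>)"
      using gap[OF aN] a \<open>s = astar\<close> d G_nonneg[of "p a"] ps(1,2)[OF aN] by (intro mult_left_mono) auto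
    finally show ?thesis by (simp add: mult.commute)
  qed
  then have "(\<Sum>a\<in>{..<N} - {astar}. drift (\<lambda>q. ln (q a + \<epsilon>)) p s)
      \<le> (\<Sum>a\<in>{..<N} - {astar}. - (\<Delta> * (G (p a) / (p a + \<epsilon>))))"
    by (rule sum_mono)
  then show ?thesis
    unfolding \<Phi>_def drift_sum[OF p] by (simp add: sum_negf sum_distrib_left)
qed

text \<open>Crude bound for states in which the optimal arm may not lead: an increment of at most
  \<open>N * p a\<close> raises each logarithm by at most \<open>N\<close>, and there are fewer than
  \<open>N\<close> logarithms.\<close>

lemma drift_log_potential_bounded:
  assumes p: "samba_simplex N p" and s: "s \<in> samba_leaders N p" and \<epsilon>: "\<epsilon> > 0"
  shows "drift (\<Phi> \<epsilon>) p s \<le> (real N)\<^sup>2"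
proof -
  note ps = samba_simplexD[OF p]
  have step: "\<Phi> \<epsilon> (upd p s b) - \<Phi> \<epsilon> p \<le> (real N)\<^sup>2" if b: "b < N" for b
  proof -
    have "\<Phi> \<epsilon> (upd p s b) - \<Phi> \<epsilon> p = (\<Sum>a\<in>{..<N} - {astar}. ln (upd p s b a + \<epsilon>) - ln (p a + \<epsilon>))"
      by (simp add: \<Phi>_def sum_subtractf)
    also have "\<dots> \<le> (\<Sum>a\<in>{..<N} - {astar}. real N)"
    proof (rule sum_mono)
      fix a assume "a \<in> {..<N} - {astar}"
      then have a: "a < N" by simp
      have "ln (upd p s b a + \<epsilon>) - ln (p a + \<epsilon>) \<le> (upd p s b a - p a) / (p a + \<epsilon>)"
        using ps(1)[OF a] upd_ge_half[OF p s a b] \<epsilon> by (intro ln_tangent) auto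
      also have "\<dots> \<le> (real N * p a) / (p a + \<epsilon>)"
        using upd_increment_le[OF p s a b] ps(1)[OF a] \<epsilon> by (intro divide_right_mono) auto
      also have "\<dots> \<le> real N"
        using ps(1)[OF a] \<epsilon> by (simp add: field_simps)
      finally show "ln (upd p s b a + \<epsilon>) - ln (p a + \<epsilon>) \<le> real N" .
    qed
    also have "\<dots> \<le> (real N)\<^sup>2"
      using astar by (simp add: power2_eq_square mult_right_mono)
    finally show ?thesis .
  qed
  have "drift (\<Phi> \<epsilon>) p s \<le> (\<Sum>b<N. p b * 1 * (real N)\<^sup>2)"
    unfolding drift_def
  proof (rule sum_mono)
    fix b assume "b \<in> {..<N}"
    then have b: "b < N" by simp
    have "p b * r b * (\<Phi> \<epsilon> (upd p s b) - \<Phi> \<epsilon> p) \<le> p b * r b * (real N)\<^sup>2"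
      using step[OF b] ps(1)[OF b] r_bounds[OF b] by (intro mult_left_mono) auto
    also have "\<dots> \<le> p b * 1 * (real N)\<^sup>2"
      using ps(1)[OF b] r_bounds[OF b] by (intro mult_mono) auto
    finally show "p b * r b * (\<Phi> \<epsilon> (upd p s b) - \<Phi> \<epsilon> p) \<le> p b * 1 * (real N)\<^sup>2" .
  qed
  also have "\<dots> = (real N)\<^sup>2" using ps(3) by (simp add: sum_distrib_right[symmetric])
  finally show ?thesis .
qed

section \<open>Convergence\<close>

declare samba_p.simps(2) [simp del]

abbreviation "M \<equiv> samba_space N r"
abbreviation "W \<equiv> samba_noise N r"
abbreviation "X t \<omega> \<equiv> samba_p \<alpha> N p0 \<omega> t"
abbreviation "Q t \<omega> \<equiv> samba_p \<alpha> N p0 \<omega> t astar"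

sublocale M: prob_space M by (rule prob_space_samba_space)
lemma prob_UNIV [simp]: "measure M UNIV = 1" using M.prob_space by simp


lemma step_simplex:
  assumes "samba_simplex N p"
  shows "samba_simplex N (samba_step \<alpha> N p w)"
  using samba_step_eq_update[OF assms N_pos, of \<alpha> "fst w" "fst (snd w)" "snd (snd w)"]
    upd_simplex[OF assms samba_leader_in_leaders[OF N_pos] samba_play_less[OF N_pos]] assms by simp

lemma X_simplex: "samba_simplex N (X t \<omega>)"
  by (induction t) (auto simp: p0 step_simplex samba_p.simps(2))

lemma step_cases:
  obtains "X (Suc t) \<omega> = X t \<omega>"
  | s b where "s \<in> samba_leaders N (X t \<omega>)" "b < N" "X (Suc t) \<omega> = upd (X t \<omega>) s b"
proof (cases "fst (\<omega> t) (samba_play N (X t \<omega>) (fst (snd (\<omega> t))))")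
  case True
  show thesis
  proof (rule that(2)[OF samba_leader_in_leaders[OF N_pos] samba_play_less[OF N_pos]])
    show "X (Suc t) \<omega> = upd (X t \<omega>) (samba_leader N (X t \<omega>) (snd (snd (\<omega> t))))
        (samba_play N (X t \<omega>) (fst (snd (\<omega> t))))"
      using True samba_step_eq_update[OF X_simplex[of \<omega> t] N_pos, of \<alpha> "fst (\<omega> t)" "fst (snd (\<omega> t))" "snd (snd (\<omega> t))"]
      by (simp add: samba_p.simps(2))
  qed
next
  case False
  show thesis
    using that(1) False samba_step_eq_update[OF X_simplex[of \<omega> t] N_pos, of \<alpha> "fst (\<omega> t)" "fst (snd (\<omega> t))" "snd (snd (\<omega> t))"]
    by (simp add: samba_p.simps(2))
qed

lemma X_coord_measurable [measurable]: "(\<lambda>\<omega>. X t \<omega> a) \<in> borel_measurable M"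
  by (rule measurable_compose[OF measurable_samba_p[OF \<alpha>_measurable] measurable_component_singleton]) simp

lemma G_measurable [measurable]: "G \<in> borel_measurable borel"
  unfolding G_def using \<alpha>_measurable by measurable

lemma Q_bounds: "0 < Q t \<omega>" "Q t \<omega> < 1"
  using astar_bounds[OF X_simplex] by auto

text \<open>A step at most halves a coordinate. The point is that \<open>1 / Q t\<close> is bounded
  at each fixed time and hence integrable.\<close>

lemma Q_ge: "p0 astar / 2 ^ t \<le> Q t \<omega>"
proof (induction t)
  case (Suc t)
  have "Q t \<omega> / 2 \<le> Q (Suc t) \<omega>"
  proof (cases rule: step_cases[of \<omega> t])
    case 1 then show ?thesis using Q_bounds[of \<omega> t] by simp
  next
    case (2 s b)
    then show ?thesis using upd_ge_half[OF X_simplex 2(1) astar 2(2)] by simp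
  qed
  then show ?case using Suc by simp
qed simp

lemma integrable_bounded:
  fixes f :: "_ \<Rightarrow> real"
  assumes "f \<in> borel_measurable M" "\<And>\<omega>. \<bar>f \<omega>\<bar> \<le> B"
  shows "integrable M f"
  by (rule M.integrable_const_bound[where B=B]) (use assms in auto)

text \<open>The inner integral averages over fresh noise at time \<open>t\<close>, as a conditional
  expectation given the past would.\<close>

lemma expectation_le:
  fixes h k :: "_ \<Rightarrow> real"
  assumes h: "integrable M h" and k: "integrable M k"
    and le: "\<And>\<omega>. (\<integral>w. h (fun_upd \<omega> t w) \<partial>W) \<le> k \<omega>"
  shows "(\<integral>\<omega>. h \<omega> \<partial>M) \<le> (\<integral>\<omega>. k \<omega> \<partial>M)"
  unfolding samba_space_resample(1)[OF h, of t]
  by (intro integral_mono samba_space_resample(2)[OF h] k le)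

lemma step_expectation_le:
  assumes "\<And>s. s \<in> samba_leaders N (X t \<omega>) \<Longrightarrow> drift f (X t \<omega>) s \<le> c"
  shows "(\<integral>w. f (X (Suc t) (fun_upd \<omega> t w)) \<partial>W) \<le> f (X t \<omega>) + c"
  using samba_step_integral_le[OF X_simplex[of \<omega> t] r_range N_pos, of f \<alpha> c] assms
  by (simp add: samba_p.simps(2) samba_p_upd drift_def)

text \<open>The drift of \<open>Q\<close> is summable because \<open>Q\<close> is a bounded submartingale, which replaces
  the martingale convergence theorem.\<close>
lemma min_Q_tendsto_0: "AE \<omega> in M. (\<lambda>t. min (Q t \<omega>) (1 - Q t \<omega>)) \<longlonglongrightarrow> 0"
proof -
  define H where "H t \<omega> = G (min (Q t \<omega>) (1 - Q t \<omega>) / N)" for t \<omega>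
  have H_meas[measurable]: "H t \<in> borel_measurable M" for t unfolding H_def by measurable
  have m: "0 < min (Q t \<omega>) (1 - Q t \<omega>) / N" "min (Q t \<omega>) (1 - Q t \<omega>) / N \<le> 1" for t \<omega>
    using Q_bounds[of \<omega> t] N by (auto simp: field_simps min_def)
  have H0: "0 \<le> H t \<omega>" for t \<omega> unfolding H_def using m by (rule G_nonneg)
  have H1: "H t \<omega> \<le> G 1" for t \<omega> unfolding H_def using m by (rule G_mono) simp
  have Hint: "integrable M (H t)" for t
    using H0 H1 by (intro integrable_bounded[where B="G 1"]) auto
  have Qint: "integrable M (Q t)" for t
    using Q_bounds by (intro integrable_bounded[where B=1]) (auto simp: less_imp_le)
  have "(\<integral>\<omega>. - Q (Suc t) \<omega> \<partial>M) \<le> (\<integral>\<omega>. - Q t \<omega> + - (\<Delta> * H t \<omega>) \<partial>M)" for t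
  proof (rule expectation_le[where t=t])
    show "integrable M (\<lambda>\<omega>. - Q (Suc t) \<omega>)" using Qint[of "Suc t"] by simp
    show "integrable M (\<lambda>\<omega>. - Q t \<omega> + - (\<Delta> * H t \<omega>))" using Qint[of t] Hint[of t] by simp
    show "(\<integral>w. - Q (Suc t) (fun_upd \<omega> t w) \<partial>W) \<le> - Q t \<omega> + - (\<Delta> * H t \<omega>)" for \<omega>
      unfolding H_def by (intro step_expectation_le[where f="\<lambda>p. - p astar"] drift_neg_astar_le[OF X_simplex])
  qed
  then have step: "\<Delta> * (\<integral>\<omega>. H t \<omega> \<partial>M) \<le> (\<integral>\<omega>. Q (Suc t) \<omega> \<partial>M) - (\<integral>\<omega>. Q t \<omega> \<partial>M)" for t
    using Qint Hint by (simp add: algebra_simps)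
  \<comment> \<open>The increments of the mean of \<open>Q\<close> telescope, and \<open>Q\<close>
    lies between 0 and 1.\<close>
  have "(\<Sum>t<n. \<integral>\<omega>. H t \<omega> \<partial>M) \<le> 1 / \<Delta>" for n
  proof -
    have "\<Delta> * (\<Sum>t<n. \<integral>\<omega>. H t \<omega> \<partial>M) \<le> (\<Sum>t<n. (\<integral>\<omega>. Q (Suc t) \<omega> \<partial>M) - (\<integral>\<omega>. Q t \<omega> \<partial>M))"
      unfolding sum_distrib_left by (intro sum_mono step)
    also have "\<dots> = (\<integral>\<omega>. Q n \<omega> \<partial>M) - (\<integral>\<omega>. Q 0 \<omega> \<partial>M)" by (rule sum_lessThan_telescope)
    also have "\<dots> \<le> 1"
    proof -
      have "(\<integral>\<omega>. Q n \<omega> \<partial>M) \<le> 1" using Q_bounds by (intro M.integral_le_const Qint) (auto simp: less_imp_le)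
      moreover have "0 \<le> (\<integral>\<omega>. Q 0 \<omega> \<partial>M)"
        using samba_simplexD(1)[OF p0 astar] by (simp add: less_imp_le)
      ultimately show ?thesis by simp
    qed
    finally show ?thesis using \<Delta>_pos by (simp add: field_simps)
  qed
  then have summ: "summable (\<lambda>t. \<integral>\<omega>. H t \<omega> \<partial>M)"
    by (intro summableI_nonneg_bounded[where x="1/\<Delta>"]) (auto intro!: integral_nonneg_AE H0)
  \<comment> \<open>Exchanging sum and integral turns summability of the means into almost sure
    summability of \<open>H\<close>.\<close>
  have "(\<integral>\<^sup>+\<omega>. (\<Sum>t. ennreal (H t \<omega>)) \<partial>M) = (\<Sum>t. \<integral>\<^sup>+\<omega>. ennreal (H t \<omega>) \<partial>M)"
    by (intro nn_integral_suminf) auto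
  also have "\<dots> = (\<Sum>t. ennreal (\<integral>\<omega>. H t \<omega> \<partial>M))"
    using H0 Hint by (simp add: nn_integral_eq_integral)
  also have "\<dots> < \<infinity>"
    using summ H0 by (simp add: suminf_ennreal2 integral_nonneg_AE)
  finally have "(\<integral>\<^sup>+\<omega>. (\<Sum>t. ennreal (H t \<omega>)) \<partial>M) \<noteq> \<infinity>" by simp
  then have "AE \<omega> in M. (\<Sum>t. ennreal (H t \<omega>)) \<noteq> \<infinity>"
    by (intro nn_integral_PInf_AE) auto
  then show ?thesis
  proof (rule AE_mp, intro AE_I2 impI)
    fix \<omega> assume "(\<Sum>t. ennreal (H t \<omega>)) \<noteq> \<infinity>"
    then have "summable (\<lambda>t. H t \<omega>)" using H0 by (intro summable_suminf_not_top) auto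
    then have lim: "(\<lambda>t. H t \<omega>) \<longlonglongrightarrow> 0" by (rule summable_LIMSEQ_zero)
    show "(\<lambda>t. min (Q t \<omega>) (1 - Q t \<omega>)) \<longlonglongrightarrow> 0"
    proof (rule order_tendstoI)
      fix e :: real assume "e < 0"
      then show "eventually (\<lambda>t. e < min (Q t \<omega>) (1 - Q t \<omega>)) sequentially"
        using Q_bounds by (auto intro!: always_eventually simp: min_def intro: less_trans)
    next
      fix e :: real assume e: "0 < e"
      \<comment> \<open>The cap at 1 keeps \<open>d\<close> in the range where \<open>G\<close> is
        positive and increasing, so that \<open>H t \<omega> < G d\<close> forces the argument of
        \<open>G\<close> below \<open>d\<close>.\<close>
      define d where "d = min e 1 / N"
      have d: "0 < d" "d \<le> 1" using e N by (auto simp: d_def field_simps min_def)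
      have "eventually (\<lambda>t. H t \<omega> < G d) sequentially"
        using order_tendstoD(2)[OF lim] G_pos[OF d] by simp
      then show "eventually (\<lambda>t. min (Q t \<omega>) (1 - Q t \<omega>) < e) sequentially"
      proof eventually_elim
        case (elim t)
        have "\<not> d \<le> min (Q t \<omega>) (1 - Q t \<omega>) / N"
          using elim G_mono[OF d(1) _ m(2)[of \<omega> t]] unfolding H_def by auto
        then have "min (Q t \<omega>) (1 - Q t \<omega>) / N < e / N"
          using N by (auto simp: d_def min_def not_le divide_less_cancel split: if_splits)
        then show ?case using N by (simp add: divide_less_cancel)
      qed
    qed
  qed
qed

text \<open>Once the minimum stays below \<open>c\<close>, each \<open>Q t\<close> is below
  \<open>c\<close> or above \<open>1 - c\<close>. A path below \<open>c\<close> cannot leap across,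
  since it grows by a factor of at most 3/2 per step, so the path ends up on one side for
  good.\<close>

lemma Q_dichotomy:
  assumes lim: "(\<lambda>t. min (Q t \<omega>) (1 - Q t \<omega>)) \<longlonglongrightarrow> 0"
  shows "(\<lambda>t. Q t \<omega>) \<longlonglongrightarrow> 0 \<or> (\<lambda>t. Q t \<omega>) \<longlonglongrightarrow> 1"
proof -
  \<comment> \<open>Below \<open>c < 1 / N\<close> the optimal arm does not lead, and
    \<open>3/2 * c \<le> 1/4\<close> is less than \<open>1 - c\<close>.\<close>
  define c where "c = 1 / (3 * real N)"
  have c: "0 < c" "c \<le> 1/6" using N by (auto simp: c_def field_simps)
  obtain n where n: "\<And>t. t \<ge> n \<Longrightarrow> min (Q t \<omega>) (1 - Q t \<omega>) < c"
    using order_tendstoD(2)[OF lim c(1)] unfolding eventually_sequentially by auto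
  have stay: "Q (Suc t) \<omega> < c" if t: "t \<ge> n" "Q t \<omega> < c" for t
  proof -
    have "Q (Suc t) \<omega> \<le> 3/2 * Q t \<omega>"
    proof (cases rule: step_cases[of \<omega> t])
      case 1 then show ?thesis using Q_bounds[of \<omega> t] by simp
    next
      case (2 s b)
      have "s \<noteq> astar"
      proof
        assume "s = astar"
        then have "1 \<le> real N * Q t \<omega>" using leader_ge[OF X_simplex 2(1)] by simp
        also have "\<dots> < real N * c" using t N by (intro mult_strict_left_mono) auto
        finally show False using N by (simp add: c_def)
      qed
      then show ?thesis using upd_other_le[OF X_simplex 2(1) astar, of b] 2(3) by simp
    qed
    then have "\<not> 1 - Q (Suc t) \<omega> < c" using t c by simp
    moreover have "min (Q (Suc t) \<omega>) (1 - Q (Suc t) \<omega>) < c" using n[of "Suc t"] t(1) by simp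
    ultimately show ?thesis by (simp add: min_def split: if_splits)
  qed
  show ?thesis
  proof (cases "\<exists>t\<ge>n. Q t \<omega> < c")
    case True
    then obtain t0 where t0: "t0 \<ge> n" "Q t0 \<omega> < c" by auto
    have small: "Q t \<omega> < c" if "t \<ge> t0" for t
      using that by (induction t rule: dec_induct) (use t0 stay in auto)
    have "eventually (\<lambda>t. min (Q t \<omega>) (1 - Q t \<omega>) = Q t \<omega>) sequentially"
      unfolding eventually_sequentially
    proof (intro exI[of _ t0] allI impI)
      fix t assume "t0 \<le> t"
      from small[OF this] show "min (Q t \<omega>) (1 - Q t \<omega>) = Q t \<omega>" using c by (simp add: min_def)
    qed
    from iffD1[OF tendsto_cong[OF this] lim] show ?thesis by simp
  next
    case False
    have "eventually (\<lambda>t. min (Q t \<omega>) (1 - Q t \<omega>) = 1 - Q t \<omega>) sequentially"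
      unfolding eventually_sequentially
    proof (intro exI[of _ n] allI impI)
      fix t assume t: "n \<le> t"
      with False n[OF t] show "min (Q t \<omega>) (1 - Q t \<omega>) = 1 - Q t \<omega>" by (auto simp: min_def)
    qed
    from tendsto_diff[OF tendsto_const[of 1] iffD1[OF tendsto_cong[OF this] lim]] show ?thesis by simp
  qed
qed

text \<open>Since \<open>\<alpha>\<close> vanishes at 0, \<open>1 / Q\<close> is a supermartingale as long as \<open>Q\<close> stays small,
  so by Fatou's lemma it cannot diverge.\<close>
lemma Q_not_tendsto_0: "AE \<omega> in M. \<not> (\<lambda>t. Q t \<omega>) \<longlonglongrightarrow> 0"
proof -
  have "eventually (\<lambda>x. \<alpha> x < \<Delta> / 2) (at_right 0)"
    using order_tendstoD(2)[OF \<alpha>_lim, of "\<Delta> / 2"] \<Delta>_pos by simp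
  then obtain d where d: "d > 0" "\<And>x. 0 < x \<Longrightarrow> x < d \<Longrightarrow> \<alpha> x < \<Delta> / 2"
    unfolding eventually_at_right_field by auto
  \<comment> \<open>\<open>e\<close> combines the two smallness conditions under which
    \<open>1 / Q\<close> has nonpositive drift.\<close>
  define e where "e = min d (1 / N)"
  have e: "0 < e" using d N by (simp add: e_def)
  \<comment> \<open>Localisation: this event is decided by the noise before \<open>t\<close>, so
    resampling the noise at \<open>t\<close> does not affect it.\<close>
  define A where "A n t = {\<omega> \<in> space M. \<forall>i\<in>{n..t}. Q i \<omega> < e}" for n t
  have A_sets[measurable]: "A n t \<in> sets M" for n t unfolding A_def by measurable
  have A_upd: "fun_upd \<omega> t w \<in> A n t \<longleftrightarrow> \<omega> \<in> A n t" for \<omega> t w n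
    by (auto simp: A_def samba_p_upd)
  define Y where "Y n t \<omega> = indicator (A n t) \<omega> * (1 / Q t \<omega>)" for n t \<omega>
  \<comment> \<open>\<open>Z\<close> pairs the indicator known at time \<open>t\<close> with the
    value at \<open>Suc t\<close>. It dominates \<open>Y n (Suc t)\<close>, and resampling the noise
    at \<open>t\<close> acts only on its second factor.\<close>
  define Z where "Z n t \<omega> = indicator (A n t) \<omega> * (1 / Q (Suc t) \<omega>)" for n t \<omega>
  have inv: "0 < 1 / Q t \<omega>" "1 / Q t \<omega> \<le> 2 ^ t / p0 astar" for t \<omega>
  proof -
    show "0 < 1 / Q t \<omega>" using Q_bounds[of \<omega> t] by simp
    have "0 < p0 astar" using Q_bounds(1)[of _ 0] by simp
    then show "1 / Q t \<omega> \<le> 2 ^ t / p0 astar"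
      using Q_ge[of t \<omega>] Q_bounds(1)[of \<omega> t] by (simp add: field_simps)
  qed
  have ind: "\<bar>indicator S \<omega> * x\<bar> \<le> B" if "0 < x" "x \<le> B" for S and x B :: real and \<omega> :: "nat \<Rightarrow> (nat \<Rightarrow> bool) \<times> real \<times> real"
    using that by (simp add: indicator_def)
  have Y_int: "integrable M (Y n t)" for n t
    unfolding Y_def by (rule integrable_bounded[OF _ ind[OF inv]]) measurable
  have Z_int: "integrable M (Z n t)" for n t
    unfolding Z_def by (rule integrable_bounded[OF _ ind[OF inv]]) measurable
  have Y_step: "(\<integral>\<omega>. Y n (Suc t) \<omega> \<partial>M) \<le> (\<integral>\<omega>. Y n t \<omega> \<partial>M)" if "n \<le> t" for n t
  proof -
    have "(\<integral>\<omega>. Y n (Suc t) \<omega> \<partial>M) \<le> (\<integral>\<omega>. Z n t \<omega> \<partial>M)"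
    proof (intro integral_mono Y_int Z_int)
      fix \<omega>
      have "indicator (A n (Suc t)) \<omega> \<le> (indicator (A n t) \<omega> :: real)"
        by (auto simp: A_def indicator_def)
      then show "Y n (Suc t) \<omega> \<le> Z n t \<omega>"
        unfolding Y_def Z_def using inv(1)[of \<omega> "Suc t"] by (intro mult_right_mono) auto
    qed
    also have "\<dots> \<le> (\<integral>\<omega>. Y n t \<omega> \<partial>M)"
    proof (rule expectation_le[OF Z_int Y_int, where t=t])
      fix \<omega>
      show "(\<integral>w. Z n t (fun_upd \<omega> t w) \<partial>W) \<le> Y n t \<omega>"
      proof (cases "\<omega> \<in> A n t")
        case False then show ?thesis by (simp add: Z_def Y_def A_upd)
      next
        case True
        then have small: "Q t \<omega> < e" using that by (auto simp: A_def)
        have "(\<integral>w. 1 / X (Suc t) (fun_upd \<omega> t w) astar \<partial>W) \<le> 1 / X t \<omega> astar + 0"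
          using small d(2)[of "Q t \<omega>"] Q_bounds(1)[of \<omega> t]
          by (intro step_expectation_le[where f="\<lambda>p. 1 / p astar"] drift_inverse_le[OF X_simplex])
            (auto simp: e_def less_imp_le)
        then show ?thesis using True by (simp add: Z_def Y_def A_upd)
      qed
    qed
    finally show ?thesis .
  qed
  have fin: "AE \<omega> in M. liminf (\<lambda>t. ennreal (Y n t \<omega>)) \<noteq> \<infinity>" for n
  proof (rule nn_integral_PInf_AE)
    have [measurable]: "Y n t \<in> borel_measurable M" for t using Y_int by auto
    show "(\<lambda>\<omega>. liminf (\<lambda>t. ennreal (Y n t \<omega>))) \<in> borel_measurable M" by measurable
    have Y0: "0 \<le> Y n t \<omega>" for t \<omega>
      unfolding Y_def using inv(1)[of \<omega> t] by (simp add: indicator_def)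
    have bound: "(\<integral>\<omega>. Y n t \<omega> \<partial>M) \<le> (\<integral>\<omega>. Y n n \<omega> \<partial>M)" if "n \<le> t" for t
      using that by (induction t rule: dec_induct) (use Y_step order.trans in blast)+
    have "(\<integral>\<^sup>+\<omega>. liminf (\<lambda>t. ennreal (Y n t \<omega>)) \<partial>M) \<le> liminf (\<lambda>t. \<integral>\<^sup>+\<omega>. ennreal (Y n t \<omega>) \<partial>M)"
      by (intro nn_integral_liminf) auto
    also have "\<dots> \<le> liminf (\<lambda>t. ennreal (\<integral>\<omega>. Y n n \<omega> \<partial>M))"
      unfolding nn_integral_eq_integral[OF Y_int AE_I2[OF Y0]]
      by (intro Liminf_mono eventually_sequentiallyI[of n] ennreal_leI bound)
    also have "\<dots> = ennreal (\<integral>\<omega>. Y n n \<omega> \<partial>M)" by (simp add: Liminf_const)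
    finally show "(\<integral>\<^sup>+\<omega>. liminf (\<lambda>t. ennreal (Y n t \<omega>)) \<partial>M) \<noteq> \<infinity>"
      by (metis ennreal_neq_top infinity_ennreal_def top_unique)
  qed
  \<comment> \<open>A path tending to 0 falls below \<open>e\<close> for good at an unknown time
    \<open>n\<close>, hence the countable quantifier.\<close>
  have "AE \<omega> in M. \<forall>n. liminf (\<lambda>t. ennreal (Y n t \<omega>)) \<noteq> \<infinity>"
    using fin by (simp add: AE_all_countable)
  then show ?thesis
  proof (rule AE_mp, intro AE_I2 impI notI)
    fix \<omega> assume fin: "\<forall>n. liminf (\<lambda>t. ennreal (Y n t \<omega>)) \<noteq> \<infinity>" and lim: "(\<lambda>t. Q t \<omega>) \<longlonglongrightarrow> 0"
    obtain n where n: "\<And>t. t \<ge> n \<Longrightarrow> Q t \<omega> < e"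
      using order_tendstoD(2)[OF lim e] unfolding eventually_sequentially by auto
    then have Y: "Y n t \<omega> = 1 / Q t \<omega>" for t by (simp add: Y_def A_def)
    have "LIM t sequentially. 1 / Q t \<omega> :> at_top"
      using filterlim_inverse_at_top[OF lim] Q_bounds(1) by (simp add: inverse_eq_divide)
    then have "(\<lambda>t. ennreal (1 / Q t \<omega>)) \<longlonglongrightarrow> \<infinity>"
      by (simp add: ennreal_tendsto_top_eq_at_top)
    then have "liminf (\<lambda>t. ennreal (1 / Q t \<omega>)) = \<infinity>"
      by (rule lim_imp_Liminf[rotated]) simp
    then show False using spec[OF fin, of n] by (simp add: Y)
  qed
qed

lemma Q_tendsto_1: "AE \<omega> in M. (\<lambda>t. Q t \<omega>) \<longlonglongrightarrow> 1"
  using min_Q_tendsto_0 Q_not_tendsto_0 by eventually_elim (use Q_dichotomy in blast)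

section \<open>Regret\<close>

lemma samba_reward_eq:
  "samba_reward \<alpha> N p0 \<omega> t = (if fst (\<omega> t) (samba_play N (X t \<omega>) (fst (snd (\<omega> t)))) then 1 else 0)"
proof -
  let ?b = "samba_play N (X t \<omega>) (fst (snd (\<omega> t)))"
  have "samba_reward \<alpha> N p0 \<omega> t = (\<Sum>a<N. if a = ?b then (if fst (\<omega> t) ?b then 1 else 0) else 0)"
    unfolding samba_reward_def by (intro sum.cong) auto
  then show ?thesis using samba_play_less[OF N_pos, of "X t \<omega>"] by (simp add: sum.delta)
qed

lemma samba_reward_range_measurable: "samba_reward \<alpha> N p0 \<omega> t \<in> {0..1}"
  "(\<lambda>\<omega>. samba_reward \<alpha> N p0 \<omega> t) \<in> borel_measurable M"
proof -
  show "samba_reward \<alpha> N p0 \<omega> t \<in> {0..1}" by (simp add: samba_reward_eq)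
  have w: "(\<lambda>\<omega>. \<omega> t) \<in> M \<rightarrow>\<^sub>M count_space UNIV \<Otimes>\<^sub>M (borel \<Otimes>\<^sub>M borel)"
    unfolding samba_space_def
    by (subst measurable_cong_sets[OF refl sets_samba_noise[symmetric]]) measurable
  have u: "(\<lambda>\<omega>. fst (snd (\<omega> t))) \<in> borel_measurable M"
    using measurable_compose[OF measurable_compose[OF w measurable_snd] measurable_fst] by simp
  have play: "(\<lambda>\<omega>. samba_play N (X t \<omega>) (fst (snd (\<omega> t)))) \<in> M \<rightarrow>\<^sub>M count_space UNIV"
    using measurable_compose[OF measurable_Pair[OF measurable_samba_p[OF \<alpha>_measurable] u] measurable_samba_play]
    by simp
  have R: "(\<lambda>\<omega>. fst (\<omega> t) a) \<in> M \<rightarrow>\<^sub>M count_space UNIV" for a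
    by (rule measurable_compose[OF measurable_compose[OF w measurable_fst]]) simp
  show "(\<lambda>\<omega>. samba_reward \<alpha> N p0 \<omega> t) \<in> borel_measurable M"
    unfolding samba_reward_def using play R by measurable
qed

lemma X_coord_integrable: "integrable M (\<lambda>\<omega>. X t \<omega> a)"
proof (rule integrable_bounded[where B=1])
  show "\<bar>X t \<omega> a\<bar> \<le> 1" for \<omega>
    using samba_simplexD(1,2,4)[OF X_simplex[of \<omega> t], of a] by (cases "a < N") auto
qed measurable

text \<open>Given the past, the reward at time \<open>t\<close> has mean
  \<open>(\<Sum>a<N. X t \<omega> a * r a)\<close>. The proof negates the reward because the
  comparison of expectations works from above.\<close>

lemma expectation_reward_ge:
  "(\<integral>\<omega>. (\<Sum>a<N. X t \<omega> a * r a) \<partial>M) \<le> (\<integral>\<omega>. samba_reward \<alpha> N p0 \<omega> t \<partial>M)"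
proof -
  have int: "integrable M (\<lambda>\<omega>. \<Sum>a<N. X t \<omega> a * r a)"
    using X_coord_integrable by (intro Bochner_Integration.integrable_sum integrable_mult_left) auto
  have rint: "integrable M (\<lambda>\<omega>. samba_reward \<alpha> N p0 \<omega> t)"
    using samba_reward_range_measurable by (intro integrable_bounded[where B=1]) (auto simp: abs_le_iff)
  have "(\<integral>\<omega>. - samba_reward \<alpha> N p0 \<omega> t \<partial>M) \<le> (\<integral>\<omega>. - (\<Sum>a<N. X t \<omega> a * r a) \<partial>M)"
  proof (rule expectation_le[where t=t])
    fix \<omega>
    let ?g = "\<lambda>(s::nat) (b::nat) x. if x then -1 else 0 :: real"
    have "(\<integral>w. ?g (samba_leader N (X t \<omega>) (snd (snd w))) (samba_play N (X t \<omega>) (fst (snd w)))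
        (fst w (samba_play N (X t \<omega>) (fst (snd w)))) \<partial>W) \<le> - (\<Sum>a<N. X t \<omega> a * r a)"
      by (rule samba_noise_integral_le[OF X_simplex r_range N_pos]) (simp add: sum_negf)
    also have "(\<integral>w. ?g (samba_leader N (X t \<omega>) (snd (snd w))) (samba_play N (X t \<omega>) (fst (snd w)))
        (fst w (samba_play N (X t \<omega>) (fst (snd w)))) \<partial>W) = (\<integral>w. - samba_reward \<alpha> N p0 (fun_upd \<omega> t w) t \<partial>W)"
      by (intro Bochner_Integration.integral_cong) (auto simp: samba_reward_eq samba_p_upd)
    finally show "(\<integral>w. - samba_reward \<alpha> N p0 (fun_upd \<omega> t w) t \<partial>W) \<le> - (\<Sum>a<N. X t \<omega> a * r a)" .
  qed (use int rint in auto)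
  then show ?thesis by simp
qed

text \<open>Each reward gap is at most 1, so the expected loss of a round is at most the mass off
  the optimal arm.\<close>

lemma regret_le_sum:
  "samba_regret \<alpha> N r astar p0 T \<le> (\<Sum>t<T. \<integral>\<omega>. 1 - Q t \<omega> \<partial>M)"
proof -
  have rint: "integrable M (\<lambda>\<omega>. samba_reward \<alpha> N p0 \<omega> t)" for t
    using samba_reward_range_measurable by (intro integrable_bounded[where B=1]) (auto simp: abs_le_iff)
  have int: "integrable M (\<lambda>\<omega>. \<Sum>a<N. X t \<omega> a * r a)" for t
    using X_coord_integrable by (intro Bochner_Integration.integrable_sum integrable_mult_left) auto
  have pt: "r astar - (\<Sum>a<N. X t \<omega> a * r a) \<le> 1 - Q t \<omega>" for t \<omega>
  proof -
    let ?p = "X t \<omega>"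
    note ps = samba_simplexD[OF X_simplex[of \<omega> t]]
    have "(\<Sum>a<N. ?p a) * r astar - (\<Sum>a<N. ?p a * r a) = (\<Sum>a<N. ?p a * (r astar - r a))"
      by (simp add: sum_distrib_right sum_subtractf right_diff_distrib)
    also have "\<dots> = (\<Sum>a\<in>{..<N} - {astar}. ?p a * (r astar - r a))"
      using astar by (simp add: sum.remove[of "{..<N}" astar])
    also have "\<dots> \<le> (\<Sum>a\<in>{..<N} - {astar}. ?p a * 1)"
    proof (intro sum_mono mult_left_mono)
      fix a assume "a \<in> {..<N} - {astar}"
      then have a: "a < N" by simp
      show "r astar - r a \<le> 1" using r_bounds(2)[OF astar] r_bounds(1)[OF a] by linarith
      show "0 \<le> ?p a" using ps(1)[OF a] by simp
    qed
    finally show ?thesis using ps(3) ps(5)[OF astar] by simp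
  qed
  have "samba_regret \<alpha> N r astar p0 T = (\<Sum>t<T. r astar - (\<integral>\<omega>. samba_reward \<alpha> N p0 \<omega> t \<partial>M))"
    unfolding samba_regret_def using rint by (simp add: sum_subtractf mult.commute)
  also have "\<dots> \<le> (\<Sum>t<T. \<integral>\<omega>. 1 - Q t \<omega> \<partial>M)"
  proof (rule sum_mono)
    fix t
    have "r astar - (\<integral>\<omega>. samba_reward \<alpha> N p0 \<omega> t \<partial>M) \<le> r astar - (\<integral>\<omega>. (\<Sum>a<N. X t \<omega> a * r a) \<partial>M)"
      using expectation_reward_ge by simp
    also have "\<dots> = (\<integral>\<omega>. r astar - (\<Sum>a<N. X t \<omega> a * r a) \<partial>M)"
      using int[of t] by simp
    also have "\<dots> \<le> (\<integral>\<omega>. 1 - Q t \<omega> \<partial>M)"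
      using int[of t] X_coord_integrable pt by (intro integral_mono) auto
    finally show "r astar - (\<integral>\<omega>. samba_reward \<alpha> N p0 \<omega> t \<partial>M) \<le> (\<integral>\<omega>. 1 - Q t \<omega> \<partial>M)" .
  qed
  finally show ?thesis .
qed

text \<open>Below \<open>\<epsilon>\<close> the first term suffices. Otherwise
  \<open>\<alpha> (p a) \<ge> \<alpha> \<epsilon>\<close> and
  \<open>p a + \<epsilon> \<le> 2 * p a\<close>, which accounts for the factor 2.\<close>

lemma coord_le_potential_decay:
  assumes p: "samba_simplex N p" and a: "a < N" and \<epsilon>: "0 < \<epsilon>" "\<epsilon> \<le> 1"
  shows "p a \<le> \<epsilon> + 2 / \<alpha> \<epsilon> * (G (p a) / (p a + \<epsilon>))"
proof (cases "p a < \<epsilon>")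
  case True
  have "0 \<le> 2 / \<alpha> \<epsilon> * (G (p a) / (p a + \<epsilon>))"
    using G_nonneg[of "p a"] samba_simplexD(1,2)[OF p a] \<alpha>_pos[OF \<epsilon>] \<epsilon> by simp
  then show ?thesis using True by simp
next
  case False
  have pa: "0 < p a" "p a \<le> 1" using samba_simplexD(1,2)[OF p a] .
  have "p a = 2 / \<alpha> \<epsilon> * (\<alpha> \<epsilon> * (p a)\<^sup>2 / (2 * p a))"
    using pa \<alpha>_pos[OF \<epsilon>] by (simp add: power2_eq_square)
  also have "\<dots> \<le> 2 / \<alpha> \<epsilon> * (G (p a) / (p a + \<epsilon>))"
    unfolding G_def using pa False \<alpha>_mono[of \<epsilon> "p a"] \<alpha>_pos[OF \<epsilon>] \<epsilon>
    by (intro mult_left_mono frac_le mult_right_mono) auto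
  finally show ?thesis using \<epsilon> by linarith
qed

text \<open>The loss of a round is charged to three sources: the bad event
  \<open>Q t \<le> 1/2\<close>, arms of mass below \<open>\<epsilon>\<close>, and the decay of the
  potential. The last is summed by telescoping.\<close>

lemma regret_bound:
  assumes \<epsilon>: "0 < \<epsilon>" "\<epsilon> \<le> 1"
  shows "samba_regret \<alpha> N r astar p0 T \<le>
    (\<Sum>t<T. measure M {\<omega> \<in> space M. Q t \<omega> \<le> 1/2}) + real N * \<epsilon> * real T
    + 2 / (\<Delta> * \<alpha> \<epsilon>) * (real N * (ln 2 - ln \<epsilon>) + (real N)\<^sup>2 * (\<Sum>t<T. measure M {\<omega> \<in> space M. Q t \<omega> \<le> 1/2}))"
proof -
  define B where "B t = {\<omega> \<in> space M. Q t \<omega> \<le> 1/2}" for t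
  \<comment> \<open>The decay is recorded only off the bad event, where the negative drift estimate
    is valid; on \<open>B t\<close> the crude bound \<open>(real N)\<^sup>2\<close> applies
    instead.\<close>
  define D where "D t \<omega> = (\<Sum>a\<in>{..<N} - {astar}. G (X t \<omega> a) / (X t \<omega> a + \<epsilon>)) * indicator (- B t) \<omega>" for t \<omega>
  have B[measurable]: "B t \<in> sets M" for t unfolding B_def by measurable
  have cB: "- B t \<in> sets M" for t using sets.compl_sets[OF B[of t]] by (simp add: Compl_eq_Diff_UNIV)
  have ps: "a < N \<Longrightarrow> 0 < X t \<omega> a" "a < N \<Longrightarrow> X t \<omega> a \<le> 1" for a t \<omega>
    using samba_simplexD(1,2)[OF X_simplex] by auto
  have ratio: "0 \<le> G (X t \<omega> a) / (X t \<omega> a + \<epsilon>)" "G (X t \<omega> a) / (X t \<omega> a + \<epsilon>) \<le> G 1 / \<epsilon>"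
    if "a < N" for a t \<omega>
    using ps[OF that, of \<omega> t] \<epsilon> G_nonneg[OF ps[OF that, of \<omega> t]] G_mono[OF ps[OF that, of \<omega> t]]
    by (auto intro!: divide_nonneg_pos frac_le)
  have D_int: "integrable M (D t)" for t
  proof (rule integrable_bounded)
    show "D t \<in> borel_measurable M" unfolding D_def using cB by measurable
    show "\<bar>D t \<omega>\<bar> \<le> (\<Sum>a\<in>{..<N} - {astar}. G 1 / \<epsilon>)" for \<omega>
    proof -
      let ?S = "\<Sum>a\<in>{..<N} - {astar}. G (X t \<omega> a) / (X t \<omega> a + \<epsilon>)"
      have "0 \<le> ?S" "?S \<le> (\<Sum>a\<in>{..<N} - {astar}. G 1 / \<epsilon>)"
        using ratio by (intro sum_nonneg sum_mono; simp)+
      then show ?thesis unfolding D_def by (auto simp del: sum_constant simp add: indicator_def)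
    qed
  qed
  have ind_int: "integrable M (indicator (B t) :: _ \<Rightarrow> real)" for t
    using B by (simp add: M.emeasure_eq_measure)
  have \<Phi>_b: "real (N - 1) * ln \<epsilon> \<le> \<Phi> \<epsilon> (X t \<omega>)" "\<Phi> \<epsilon> (X t \<omega>) \<le> real (N - 1) * ln 2" for t \<omega>
  proof -
    have "ln \<epsilon> \<le> ln (X t \<omega> a + \<epsilon>)" "ln (X t \<omega> a + \<epsilon>) \<le> ln 2" if "a < N" for a
      using ps[OF that, of \<omega> t] \<epsilon> by (simp_all add: add_pos_pos)
    then have "(\<Sum>a\<in>{..<N} - {astar}. ln \<epsilon>) \<le> \<Phi> \<epsilon> (X t \<omega>)"
      "\<Phi> \<epsilon> (X t \<omega>) \<le> (\<Sum>a\<in>{..<N} - {astar}. ln 2)"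
      unfolding \<Phi>_def by (intro sum_mono; simp)+
    then show "real (N - 1) * ln \<epsilon> \<le> \<Phi> \<epsilon> (X t \<omega>)" "\<Phi> \<epsilon> (X t \<omega>) \<le> real (N - 1) * ln 2"
      using astar by simp_all
  qed
  have \<Phi>_int: "integrable M (\<lambda>\<omega>. \<Phi> \<epsilon> (X t \<omega>))" for t
  proof (rule integrable_bounded)
    show "(\<lambda>\<omega>. \<Phi> \<epsilon> (X t \<omega>)) \<in> borel_measurable M" unfolding \<Phi>_def by measurable
    show "\<bar>\<Phi> \<epsilon> (X t \<omega>)\<bar> \<le> \<bar>real (N - 1) * ln \<epsilon>\<bar> + \<bar>real (N - 1) * ln 2\<bar>" for \<omega>
      using \<Phi>_b[of \<omega> t] by linarith
  qed
  have le: "(\<integral>\<omega>. \<Phi> \<epsilon> (X (Suc t) \<omega>) \<partial>M) \<le> (\<integral>\<omega>. \<Phi> \<epsilon> (X t \<omega>) + ((real N)\<^sup>2 * indicator (B t) \<omega> - \<Delta> * D t \<omega>) \<partial>M)" for t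
  proof (rule expectation_le[where t=t])
    show "integrable M (\<lambda>\<omega>. \<Phi> \<epsilon> (X (Suc t) \<omega>))" by (rule \<Phi>_int)
    show "integrable M (\<lambda>\<omega>. \<Phi> \<epsilon> (X t \<omega>) + ((real N)\<^sup>2 * indicator (B t) \<omega> - \<Delta> * D t \<omega>))"
      using \<Phi>_int[of t] ind_int[of t] D_int[of t] by simp
    fix \<omega>
    show "(\<integral>w. \<Phi> \<epsilon> (X (Suc t) (fun_upd \<omega> t w)) \<partial>W)
        \<le> \<Phi> \<epsilon> (X t \<omega>) + ((real N)\<^sup>2 * indicator (B t) \<omega> - \<Delta> * D t \<omega>)"
    proof (rule step_expectation_le)
      fix s assume s: "s \<in> samba_leaders N (X t \<omega>)"
      show "drift (\<Phi> \<epsilon>) (X t \<omega>) s \<le> (real N)\<^sup>2 * indicator (B t) \<omega> - \<Delta> * D t \<omega>"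
      proof (cases "\<omega> \<in> B t")
        case True
        then show ?thesis using drift_log_potential_bounded[OF X_simplex s \<epsilon>(1)] by (simp add: D_def)
      next
        case False
        then have "Q t \<omega> > 1/2" by (simp add: B_def not_le)
        then show ?thesis using drift_log_potential_le[OF X_simplex s \<epsilon>(1)] False by (simp add: D_def)
      qed
    qed
  qed
  have step: "\<Delta> * (\<integral>\<omega>. D t \<omega> \<partial>M) \<le> (\<integral>\<omega>. \<Phi> \<epsilon> (X t \<omega>) \<partial>M) - (\<integral>\<omega>. \<Phi> \<epsilon> (X (Suc t) \<omega>) \<partial>M)
      + (real N)\<^sup>2 * measure M (B t)" for t
  proof -
    have "(\<integral>\<omega>. \<Phi> \<epsilon> (X t \<omega>) + ((real N)\<^sup>2 * indicator (B t) \<omega> - \<Delta> * D t \<omega>) \<partial>M)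
        = (\<integral>\<omega>. \<Phi> \<epsilon> (X t \<omega>) \<partial>M) + ((real N)\<^sup>2 * measure M (B t) - \<Delta> * (\<integral>\<omega>. D t \<omega> \<partial>M))"
      using \<Phi>_int[of t] ind_int[of t] D_int[of t] B[of t] by simp
    then show ?thesis using le[of t] by linarith
  qed
  have "\<Delta> * (\<Sum>t<T. \<integral>\<omega>. D t \<omega> \<partial>M)
      \<le> (\<Sum>t<T. ((\<integral>\<omega>. \<Phi> \<epsilon> (X t \<omega>) \<partial>M) - (\<integral>\<omega>. \<Phi> \<epsilon> (X (Suc t) \<omega>) \<partial>M)) + (real N)\<^sup>2 * measure M (B t))"
    unfolding sum_distrib_left by (intro sum_mono step)
  also have "\<dots> = ((\<integral>\<omega>. \<Phi> \<epsilon> (X 0 \<omega>) \<partial>M) - (\<integral>\<omega>. \<Phi> \<epsilon> (X T \<omega>) \<partial>M)) + (real N)\<^sup>2 * (\<Sum>t<T. measure M (B t))"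
    using sum_lessThan_telescope'[of "\<lambda>t. \<integral>\<omega>. \<Phi> \<epsilon> (X t \<omega>) \<partial>M" T]
    unfolding sum.distrib sum_distrib_left by linarith
  \<comment> \<open>Every term of the potential lies between \<open>ln \<epsilon>\<close> and
    \<open>ln 2\<close>, which bounds its net change.\<close>
  also have "\<dots> \<le> real N * (ln 2 - ln \<epsilon>) + (real N)\<^sup>2 * (\<Sum>t<T. measure M (B t))"
  proof -
    have "(\<integral>\<omega>. \<Phi> \<epsilon> (X 0 \<omega>) \<partial>M) \<le> real (N - 1) * ln 2"
      by (intro M.integral_le_const \<Phi>_int AE_I2 \<Phi>_b)
    moreover have "real (N - 1) * ln \<epsilon> \<le> (\<integral>\<omega>. \<Phi> \<epsilon> (X T \<omega>) \<partial>M)"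
      by (intro M.integral_ge_const \<Phi>_int AE_I2 \<Phi>_b)
    moreover have "real (N - 1) * (ln 2 - ln \<epsilon>) \<le> real N * (ln 2 - ln \<epsilon>)"
    proof (rule mult_right_mono)
      have "ln \<epsilon> \<le> 0" using \<epsilon> by simp
      then show "0 \<le> ln 2 - ln \<epsilon>" using ln_ge_zero[of 2] by linarith
    qed simp
    ultimately show ?thesis by (simp add: right_diff_distrib)
  qed
  finally have sumD: "(\<Sum>t<T. \<integral>\<omega>. D t \<omega> \<partial>M)
      \<le> (real N * (ln 2 - ln \<epsilon>) + (real N)\<^sup>2 * (\<Sum>t<T. measure M (B t))) / \<Delta>"
    using \<Delta>_pos by (simp add: field_simps)
  have pt: "1 - Q t \<omega> \<le> indicator (B t) \<omega> + real N * \<epsilon> + 2 / \<alpha> \<epsilon> * D t \<omega>" for t \<omega>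
  proof (cases "\<omega> \<in> B t")
    case True
    have "0 \<le> real N * \<epsilon>" using \<epsilon> by simp
    then show ?thesis using True Q_bounds(1)[of \<omega> t] by (simp add: D_def)
  next
    case False
    have "1 - Q t \<omega> = (\<Sum>a\<in>{..<N} - {astar}. X t \<omega> a)"
      using samba_simplexD(5)[OF X_simplex astar] by simp
    also have "\<dots> \<le> (\<Sum>a\<in>{..<N} - {astar}. \<epsilon> + 2 / \<alpha> \<epsilon> * (G (X t \<omega> a) / (X t \<omega> a + \<epsilon>)))"
      using coord_le_potential_decay[OF X_simplex _ \<epsilon>] by (intro sum_mono) auto
    also have "\<dots> = real (N - 1) * \<epsilon> + 2 / \<alpha> \<epsilon> * D t \<omega>"
      using False astar by (simp add: D_def sum.distrib sum_distrib_left)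
    also have "\<dots> \<le> real N * \<epsilon> + 2 / \<alpha> \<epsilon> * D t \<omega>"
      using \<epsilon> by (intro add_right_mono mult_right_mono) auto
    finally show ?thesis using False by simp
  qed
  have "(\<integral>\<omega>. 1 - Q t \<omega> \<partial>M) \<le> measure M (B t) + real N * \<epsilon> + 2 / \<alpha> \<epsilon> * (\<integral>\<omega>. D t \<omega> \<partial>M)" for t
  proof -
    have "(\<integral>\<omega>. 1 - Q t \<omega> \<partial>M) \<le> (\<integral>\<omega>. indicator (B t) \<omega> + real N * \<epsilon> + 2 / \<alpha> \<epsilon> * D t \<omega> \<partial>M)"
      using X_coord_integrable ind_int D_int pt by (intro integral_mono) auto
    also have "\<dots> = measure M (B t) + real N * \<epsilon> + 2 / \<alpha> \<epsilon> * (\<integral>\<omega>. D t \<omega> \<partial>M)"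
      using ind_int[of t] D_int[of t] B[of t] by simp
    finally show ?thesis .
  qed
  then have "(\<Sum>t<T. \<integral>\<omega>. 1 - Q t \<omega> \<partial>M)
      \<le> (\<Sum>t<T. measure M (B t) + real N * \<epsilon> + 2 / \<alpha> \<epsilon> * (\<integral>\<omega>. D t \<omega> \<partial>M))"
    by (intro sum_mono)
  also have "\<dots> = (\<Sum>t<T. measure M (B t)) + real N * \<epsilon> * real T + 2 / \<alpha> \<epsilon> * (\<Sum>t<T. \<integral>\<omega>. D t \<omega> \<partial>M)"
    by (simp add: sum.distrib sum_distrib_left mult.commute)
  also have "\<dots> \<le> (\<Sum>t<T. measure M (B t)) + real N * \<epsilon> * real T
      + 2 / \<alpha> \<epsilon> * ((real N * (ln 2 - ln \<epsilon>) + (real N)\<^sup>2 * (\<Sum>t<T. measure M (B t))) / \<Delta>)"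
    using \<alpha>_pos[OF \<epsilon>] by (intro add_left_mono mult_left_mono sumD) auto
  finally show ?thesis
    using regret_le_sum[of T] unfolding B_def by (simp add: mult.commute)
qed

end

section \<open>Truncated learning rate and choice of the constant\<close>

lemma samba_step_cong:
  assumes p: "samba_simplex N p" and eq: "\<And>x. 0 < x \<Longrightarrow> x \<le> 1 \<Longrightarrow> \<alpha> x = \<beta> x"
  shows "samba_step \<alpha> N p w = samba_step \<beta> N p w"
proof -
  have "a < N \<Longrightarrow> \<alpha> (p a) = \<beta> (p a)" for a
    using eq samba_simplexD(1,2)[OF p] by auto
  then show ?thesis
    by (cases w) (auto simp: samba_step_def Let_def fun_eq_iff intro!: sum.cong)
qed

text \<open>Outside \<open>{0<..1}\<close> nothing is known about \<open>l\<close>, so \<open>samba_alpha l\<close> need not be measurable there.\<close>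
definition samba_rate :: "(real \<Rightarrow> real) \<Rightarrow> real \<Rightarrow> real" where
  "samba_rate l x = (if 0 < x \<and> x \<le> 1 then samba_alpha l x else 0)"

lemma samba_rate_properties:
  fixes l :: "real \<Rightarrow> real"
  assumes range: "\<forall>x\<in>{0..1}. l x \<in> {0..1}" and mono: "mono_on {0..1} l"
    and sv: "slowly_varying_at_0 l" and lim: "(l \<longlongrightarrow> 0) (at_right 0)"
  shows "samba_rate l \<in> borel_measurable borel" "(samba_rate l \<longlongrightarrow> 0) (at_right 0)"
    and "0 < x \<Longrightarrow> x \<le> 1 \<Longrightarrow> 0 < samba_rate l x" "0 < x \<Longrightarrow> x \<le> 1 \<Longrightarrow> samba_rate l x \<le> 1/2"
    and "0 < x \<Longrightarrow> x \<le> y \<Longrightarrow> y \<le> 1 \<Longrightarrow> samba_rate l x \<le> samba_rate l y"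
proof -
  have lpos: "0 < l x" if "0 < x" "x \<le> 1" for x
    using sv that unfolding slowly_varying_at_0_def by auto
  have pos: "0 < samba_rate l x" if "0 < x" "x \<le> 1" for x
    using samba_alpha_ge[OF range mono that] lpos[of "x/4"] that by (simp add: samba_rate_def)
  have le: "samba_rate l x \<le> l x / 2" if "0 < x" "x \<le> 1" for x
    using samba_alpha_le[OF range mono that] that by (simp add: samba_rate_def)
  show "0 < x \<Longrightarrow> x \<le> 1 \<Longrightarrow> 0 < samba_rate l x" by (rule pos)
  show "samba_rate l x \<le> 1/2" if "0 < x" "x \<le> 1"
    using le[OF that] bspec[OF range, of x] that by simp
  show "0 < x \<Longrightarrow> x \<le> y \<Longrightarrow> y \<le> 1 \<Longrightarrow> samba_rate l x \<le> samba_rate l y"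
    using samba_alpha_mono[OF range mono, of x y] by (simp add: samba_rate_def)
  \<comment> \<open>Monotonicity yields measurability on the half-open interval, and extension by 0
    makes it global.\<close>
  have "mono_on {0<..1} (samba_alpha l)"
    by (intro mono_onI samba_alpha_mono[OF range mono]) auto
  from borel_measurable_mono_on_fnc[OF this]
  have "(\<lambda>x. if x \<in> {0<..1} then samba_alpha l x else 0) \<in> borel_measurable borel"
    by (subst (asm) measurable_restrict_space_iff[where c=0]) auto
  then show "samba_rate l \<in> borel_measurable borel" by (simp add: samba_rate_def[abs_def])
  have ev: "eventually (\<lambda>x. 0 < x \<and> x \<le> (1::real)) (at_right 0)"
    unfolding eventually_at_right_field by (intro exI[of _ 1]) auto
  show "(samba_rate l \<longlongrightarrow> 0) (at_right 0)"
  proof (rule tendsto_sandwich)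
    show "eventually (\<lambda>x. 0 \<le> samba_rate l x) (at_right 0)"
      using ev by eventually_elim (use pos in \<open>auto intro: less_imp_le\<close>)
    show "eventually (\<lambda>x. samba_rate l x \<le> l x / 2) (at_right 0)"
      using ev by eventually_elim (use le in auto)
    show "((\<lambda>x. l x / 2) \<longlongrightarrow> 0) (at_right 0)" using tendsto_divide[OF lim tendsto_const[of 2]] by simp
  qed simp
qed

theorem theorem4:
  fixes l :: "real \<Rightarrow> real" and N :: nat and r p0 :: "nat \<Rightarrow> real" and astar :: nat
  assumes l_range: "\<forall>x\<in>{0..1}. l x \<in> {0..1}"
    and l_mono: "mono_on {0..1} l"
    and l_sv: "slowly_varying_at_0 l"
    and l_lim: "(l \<longlongrightarrow> 0) (at_right 0)"
    and N: "N \<ge> 2"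
    and astar: "astar < N"
    and r_range: "\<forall>a<N. r a \<in> {0..1}"
    and r_opt: "\<forall>a<N. a \<noteq> astar \<longrightarrow> r a < r astar"
    and p0_pos: "\<forall>a<N. p0 a > 0"
    and p0_sum: "(\<Sum>a<N. p0 a) = 1"
    and p0_out: "\<forall>a\<ge>N. p0 a = 0"
  shows "markov_chain (samba_space N r) (\<Pi>\<^sub>M a\<in>(UNIV::nat set). (borel :: real measure))
           (\<lambda>t \<omega>. samba_p (samba_alpha l) N p0 \<omega> t)
         \<and> (AE \<omega> in samba_space N r.
              (\<lambda>t. samba_p (samba_alpha l) N p0 \<omega> t astar) \<longlonglongrightarrow> 1)
         \<and> (\<exists>C>0. \<forall>T::nat. T \<ge> 1 \<longrightarrow>
              C / ((r astar - Max (r ` ({..<N} - {astar}))) * real T) \<le> 1 \<longrightarrow>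
              summable (\<lambda>t. measure (samba_space N r)
                 {\<omega> \<in> space (samba_space N r). samba_p (samba_alpha l) N p0 \<omega> t astar \<le> 1/2}) \<longrightarrow>
              samba_regret (samba_alpha l) N r astar p0 T
                \<le> C * real N / ((r astar - Max (r ` ({..<N} - {astar})))
                     * l (C / ((r astar - Max (r ` ({..<N} - {astar}))) * real T))) * ln (real T)
                  + (\<Sum>t. measure (samba_space N r)
                      {\<omega> \<in> space (samba_space N r). samba_p (samba_alpha l) N p0 \<omega> t astar \<le> 1/2})
                  + 1)"
proof -
  let ?\<Delta> = "r astar - Max (r ` ({..<N} - {astar}))"
  define \<Delta> where "\<Delta> = ?\<Delta>"
  define \<beta> where "\<beta> = samba_rate l"
  have p0: "samba_simplex N p0"
    using p0_pos p0_sum p0_out by (simp add: samba_simplex_def)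
  obtain a0 where a0: "a0 < N" "a0 \<noteq> astar"
    using N by (cases "astar = 0") (auto intro: that[of 1] that[of 0])
  have fin: "finite (r ` ({..<N} - {astar}))" "r ` ({..<N} - {astar}) \<noteq> {}" using a0 by auto
  have gap: "r a + \<Delta> \<le> r astar" if "a < N" "a \<noteq> astar" for a
    using Max_ge[OF fin(1), of "r a"] that by (auto simp: \<Delta>_def)
  have "\<Delta> > 0"
    using Max_in[OF fin] r_opt by (auto simp: \<Delta>_def)
  note trunc = samba_rate_properties[OF l_range l_mono l_sv l_lim, folded \<beta>_def]
  interpret S: samba \<beta> N r p0 astar \<Delta>
    using trunc N astar r_range \<open>\<Delta> > 0\<close> gap p0 by unfold_locales auto
  \<comment> \<open>All coordinates of a state below \<open>N\<close> lie in (0,1], where the two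
    rates agree, so both produce the same path for every noise sequence.\<close>
  have X_eq: "samba_p (samba_alpha l) N p0 \<omega> t = samba_p \<beta> N p0 \<omega> t" for \<omega> t
  proof (induction t)
    case (Suc t)
    have "samba_alpha l x = \<beta> x" if "0 < x" "x \<le> 1" for x
      using that by (simp add: \<beta>_def samba_rate_def)
    from samba_step_cong[OF S.X_simplex[of \<omega> t] this] Suc
    show ?case by (simp only: samba_p.simps(2))
  qed simp
  have reg_eq: "samba_regret (samba_alpha l) N r astar p0 T = samba_regret \<beta> N r astar p0 T" for T
    by (simp add: samba_regret_def samba_reward_def X_eq)
  obtain c0 where c0: "c0 > 0" "\<And>x. 0 < x \<Longrightarrow> x \<le> 1 \<Longrightarrow> c0 * l x \<le> l (x / 4)"
    using slowly_varying_quarter_ratio[OF l_range l_mono l_sv] by blast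
  define c where "c = c0 / 8"
  have c: "c > 0" "\<And>x. 0 < x \<Longrightarrow> x \<le> 1 \<Longrightarrow> c * l x \<le> \<beta> x"
    using c0 samba_alpha_ge[OF l_range l_mono] by (auto simp: c_def \<beta>_def samba_rate_def intro: order.trans[rotated])
  let ?P = "\<lambda>t. measure S.M {\<omega> \<in> space S.M. samba_p \<beta> N p0 \<omega> t astar \<le> 1/2}"
  \<comment> \<open>\<open>K\<close> is the expected time spent with \<open>Q \<le> 1/2\<close>.
    Since \<open>C\<close> is fixed before summability is assumed, the divergent case also needs a
    value, here 0.\<close>
  define K where "K = (if summable ?P then suminf ?P else 0)"
  have K: "K \<ge> 0" by (auto simp: K_def intro: suminf_nonneg)
  \<comment> \<open>\<open>exp 2\<close> forces \<open>ln T \<ge> 2\<close> in the admissible range.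
    The second entry absorbs the ratio \<open>c\<close> between the rate and \<open>l\<close>, and
    the factor \<open>1 + N * K\<close> that comes from the crude drift bound.\<close>
  define C where "C = max (exp 2) (4 * (1 + real N * K) / c)"
  have C: "exp 2 \<le> C" "4 * (1 + real N * K) / c \<le> C" by (auto simp: C_def)
  have C2: "2 \<le> C" using C(1) exp_ge_add_one_self[of 2] by linarith
  have main: "samba_regret \<beta> N r astar p0 T \<le> C * real N / (\<Delta> * l (C / (\<Delta> * real T))) * ln (real T) + suminf ?P + 1"
    if T: "T \<ge> 1" "C / (\<Delta> * real T) \<le> 1" and summ: "summable ?P" for T
  proof -
    define \<epsilon> where "\<epsilon> = C / (\<Delta> * real T)"
    have \<epsilon>: "0 < \<epsilon>" "\<epsilon> \<le> 1" using T C2 \<open>\<Delta> > 0\<close> by (auto simp: \<epsilon>_def)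
    have l: "0 < l \<epsilon>" "l \<epsilon> \<le> 1"
      using l_sv \<epsilon> l_range unfolding slowly_varying_at_0_def by auto
    have CT: "C \<le> \<Delta> * real T" using T \<open>\<Delta> > 0\<close> by (simp add: field_simps)
    also have "\<dots> \<le> real T" using mult_right_mono[OF S.\<Delta>_le_1, of "real T"] by simp
    finally have "exp 2 \<le> real T" using C by linarith
    then have lnT: "2 \<le> ln (real T)" using T by (simp add: ln_ge_iff)
    have sumP: "(\<Sum>t<T. ?P t) \<le> K" "K = suminf ?P" "0 \<le> (\<Sum>t<T. ?P t)"
      using summ by (auto simp: K_def intro!: sum_le_suminf sum_nonneg)
    have "ln 2 - ln \<epsilon> = ln (2 / \<epsilon>)" using \<epsilon> by (simp add: ln_div)
    also have "\<dots> \<le> ln (real T)"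
    proof -
      have "2 / \<epsilon> = 2 / C * \<Delta> * real T" by (simp add: \<epsilon>_def)
      also have "\<dots> \<le> 1 * 1 * real T"
        using C2 S.\<Delta>_le_1 \<open>\<Delta> > 0\<close> by (intro mult_mono) auto
      finally show ?thesis using \<epsilon> T by (simp add: ln_mono)
    qed
    finally have ln\<epsilon>: "ln 2 - ln \<epsilon> \<le> ln (real T)" .
    \<comment> \<open>\<open>u\<close> is the leading term divided by \<open>C\<close>; the two
      error terms receive \<open>C / 2\<close> of it each.\<close>
    define u where "u = real N * ln (real T) / (\<Delta> * l \<epsilon>)"
    have u: "0 \<le> u" using lnT l \<open>\<Delta> > 0\<close> by (simp add: u_def)
    \<comment> \<open>The left side equals \<open>C * N / \<Delta>\<close>; the rest is
      \<open>ln T \<ge> 2\<close> and \<open>l \<epsilon> \<le> 1\<close>.\<close>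
    have 1: "real N * \<epsilon> * real T \<le> C / 2 * u"
    proof -
      have "real N * \<epsilon> * real T = C / 2 * (real N * 2 / (\<Delta> * 1))"
        using T \<open>\<Delta> > 0\<close> by (simp add: \<epsilon>_def)
      also have "\<dots> \<le> C / 2 * u"
        unfolding u_def using l lnT \<open>\<Delta> > 0\<close> C2
        by (intro mult_left_mono frac_le mult_mono) auto
      finally show ?thesis .
    qed
    have 2: "2 / (\<Delta> * \<beta> \<epsilon>) * (real N * (ln 2 - ln \<epsilon>) + (real N)\<^sup>2 * (\<Sum>t<T. ?P t)) \<le> C / 2 * u"
    proof -
      \<comment> \<open>As \<open>ln T \<ge> 1\<close>, the bounded time in the bad event may be
        multiplied by \<open>ln T\<close> and merged with the logarithmic term.\<close>
      have "real N * (ln 2 - ln \<epsilon>) + (real N)\<^sup>2 * (\<Sum>t<T. ?P t)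
          \<le> real N * ln (real T) + (real N)\<^sup>2 * (K * ln (real T))"
      proof (intro add_mono mult_left_mono ln\<epsilon>)
        have "K * 1 \<le> K * ln (real T)" using K lnT by (intro mult_left_mono) auto
        then show "(\<Sum>t<T. ?P t) \<le> K * ln (real T)" using sumP by linarith
      qed auto
      also have "\<dots> = (1 + real N * K) * (real N * ln (real T))"
        by (simp add: power2_eq_square algebra_simps)
      finally have "2 / (\<Delta> * \<beta> \<epsilon>) * (real N * (ln 2 - ln \<epsilon>) + (real N)\<^sup>2 * (\<Sum>t<T. ?P t))
          \<le> 2 / (\<Delta> * \<beta> \<epsilon>) * ((1 + real N * K) * (real N * ln (real T)))"
        using \<open>\<Delta> > 0\<close> S.\<alpha>_pos[OF \<epsilon>] by (intro mult_left_mono) auto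
      also have "\<dots> \<le> 2 / (\<Delta> * (c * l \<epsilon>)) * ((1 + real N * K) * (real N * ln (real T)))"
        using \<open>\<Delta> > 0\<close> c \<epsilon> l K lnT S.\<alpha>_pos[OF \<epsilon>]
        by (intro mult_right_mono divide_left_mono mult_left_mono mult_nonneg_nonneg add_nonneg_nonneg) auto
      also have "\<dots> = (4 * (1 + real N * K) / c) / 2 * u"
      proof -
        have "2 / (\<Delta> * (c * y)) * (k * x) = (4 * k / c) / 2 * (x / (\<Delta> * y))" for k x y :: real
          by (simp add: mult_ac)
        then show ?thesis unfolding u_def .
      qed
      also have "\<dots> \<le> C / 2 * u"
        by (intro mult_right_mono divide_right_mono C(2) u) simp
      finally show ?thesis .
    qed
    have "samba_regret \<beta> N r astar p0 T \<le> suminf ?P + C / 2 * u + C / 2 * u"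
      using S.regret_bound[OF \<epsilon>, of T] 1 2 sumP by linarith
    moreover have "C * u = C * real N / (\<Delta> * l \<epsilon>) * ln (real T)"
      by (simp add: u_def)
    ultimately show ?thesis unfolding \<epsilon>_def by linarith
  qed
  have "markov_chain (samba_space N r) state_space (\<lambda>t \<omega>. samba_p \<beta> N p0 \<omega> t)"
    by (rule samba_markov_chain[OF S.\<alpha>_measurable])
  moreover note S.Q_tendsto_1
  moreover have "C > 0" using C2 by simp
  ultimately show ?thesis
    unfolding X_eq reg_eq using main unfolding \<Delta>_def by blast
qed

end
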